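(* Let $r\ge 2$ and $N\ge1$ be integers and suppose there exists an $r$-coloring of $\mathbb{Z}/N\mathbb{Z}$ with no symmetrically colored 4-AP. Then there is a constant $C$ (depending on $r,N$) such that for all $0<\alpha<1/2$, \[\rho_4(\alpha)\le C\,\alpha^{3+\frac12\log_r N}.\]
   Context: In $\mathbb{Z}/N\mathbb{Z}$, a 4-AP $n,n+d,n+2d,n+3d$ with $d\neq0$ is symmetrically colored if $n$ and $n+3d$ have the same color and $n+d$ and $n+2d$ have the same color. For $f\colon\mathbb{Z}/N\mathbb{Z}\to\mathbb{C}$, $\widehat f(r)=\mathbb{E}_{n}f(n)e^{-2\pi i rn/N}$; $A\subset\mathbb{Z}/N\mathbb{Z}$ is $\eta$-Fourier uniform if $|\widehat{1_A}(r)|\le\eta$ for all $r\ne0$. $\Lambda_4(f)=\mathbb{E}_{n,d\in\mathbb{Z}/N\mathbb{Z}}f(n)f(n+d)f(n+2d)f(n+3d)$. For $0<\alpha<1$, $\rho_4(\alpha)$ is the largest real number such that for every $\epsilon>0$ there exist $\eta>0$ and $N_0$ such that every $\eta$-Fourier uniform $A\subset\mathbb{Z}/N\mathbb{Z}$ with $N\ge N_0$ and $|A|\ge(\alpha-\epsilon)N$ satisfies $\Lambda_4(1_A)\ge\rho_4(\alpha)-\epsilon$. *)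

theory Defs
  imports "HOL-Analysis.Analysis"
begin

text \<open>
  The group of integers modulo \<open>N\<close> is represented by the residues \<open>{0..<int N}\<close>, with all
  arithmetic reduced modulo \<open>N\<close>. Functions on the group are functions \<open>int \<Rightarrow> 'a\<close> of which
  only the values at these residues are ever used.
\<close>

definition ZMod :: "nat \<Rightarrow> int set" where
  "ZMod N = {0..<int N}"

definition AP4 :: "nat \<Rightarrow> int \<Rightarrow> int \<Rightarrow> nat \<Rightarrow> int" where
  "AP4 N n d k = (n + int k * d) mod int N"

definition coloring :: "nat \<Rightarrow> nat \<Rightarrow> (int \<Rightarrow> nat) \<Rightarrow> bool" where
  "coloring r N c \<longleftrightarrow> (\<forall>n\<in>ZMod N. c n < r)"

text \<open>
  Only \<open>d \<noteq> 0\<close> is required: if \<open>N\<close> is not coprime to 6, the four terms of a progression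
  need not be distinct.
\<close>

definition symmetrically_colored :: "nat \<Rightarrow> (int \<Rightarrow> nat) \<Rightarrow> int \<Rightarrow> int \<Rightarrow> bool" where
  "symmetrically_colored N c n d \<longleftrightarrow>
     c (AP4 N n d 0) = c (AP4 N n d 3) \<and> c (AP4 N n d 1) = c (AP4 N n d 2)"

definition has_symmetric_4AP :: "nat \<Rightarrow> (int \<Rightarrow> nat) \<Rightarrow> bool" where
  "has_symmetric_4AP N c \<longleftrightarrow>
     (\<exists>n\<in>ZMod N. \<exists>d\<in>ZMod N. d \<noteq> 0 \<and> symmetrically_colored N c n d)"

definition fourier_coeff :: "nat \<Rightarrow> (int \<Rightarrow> complex) \<Rightarrow> int \<Rightarrow> complex" where
  "fourier_coeff N f r =
     (\<Sum>n\<in>ZMod N. f n * exp (- 2 * of_real pi * \<i> * of_int r * of_int n / of_nat N)) / of_nat N"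

definition fourier_uniform :: "real \<Rightarrow> nat \<Rightarrow> int set \<Rightarrow> bool" where
  "fourier_uniform \<eta> N A \<longleftrightarrow>
     (\<forall>r\<in>ZMod N. r \<noteq> 0 \<longrightarrow> norm (fourier_coeff N (indicator A) r) \<le> \<eta>)"

definition Lambda4 :: "nat \<Rightarrow> (int \<Rightarrow> 'a::field_char_0) \<Rightarrow> 'a" where
  "Lambda4 N f =
     (\<Sum>n\<in>ZMod N. \<Sum>d\<in>ZMod N.
        f (AP4 N n d 0) * f (AP4 N n d 1) * f (AP4 N n d 2) * f (AP4 N n d 3)) / (of_nat N)\<^sup>2"

definition rho4_admissible :: "real \<Rightarrow> real \<Rightarrow> bool" where
  "rho4_admissible \<alpha> \<rho> \<longleftrightarrow>
     (\<forall>\<epsilon>>0. \<exists>\<eta>>0. \<exists>N0::nat. \<forall>N\<ge>N0. \<forall>A. 0 < N \<and> A \<subseteq> ZMod N \<and> fourier_uniform \<eta> N A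
        \<and> real (card A) \<ge> (\<alpha> - \<epsilon>) * real N
        \<longrightarrow> Lambda4 N (indicat_real A) \<ge> \<rho> - \<epsilon>)"

text \<open>
  The largest admissible number, taken as a supremum. The lemmas below show that the supremum
  is over a nonempty set bounded above, and that it is the largest admissible number whenever
  one exists.
\<close>

definition rho4 :: "real \<Rightarrow> real" where
  "rho4 \<alpha> = Sup {\<rho>. rho4_admissible \<alpha> \<rho>}"

lemma rho4_admissible_zero: "rho4_admissible \<alpha> 0"
proof -
  have "Lambda4 N (indicat_real A) \<ge> 0" for N A
    unfolding Lambda4_def by (intro divide_nonneg_nonneg sum_nonneg mult_nonneg_nonneg) auto
  then have "Lambda4 N (indicat_real A) \<ge> 0 - \<epsilon>" if "\<epsilon> > 0" for N A \<epsilon>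
    using that by (smt (verit))
  then show ?thesis
    unfolding rho4_admissible_def using zero_less_one by blast
qed

lemma AP4_in_ZMod: "N > 0 \<Longrightarrow> AP4 N n d k \<in> ZMod N"
  by (simp add: AP4_def ZMod_def)

lemma fourier_coeff_ZMod:
  assumes "r \<in> ZMod N" "r \<noteq> 0"
  shows "fourier_coeff N (indicator (ZMod N)) r = 0"
proof -
  have N: "N > 0" and r: "0 < r" "r < int N"
    using assms by (auto simp: ZMod_def)
  define w :: complex where "w = exp (- 2 * of_real pi * \<i> * of_int r / of_nat N)"
  have wN: "w ^ N = 1"
  proof -
    have "w ^ N = exp (of_nat N * (- 2 * of_real pi * \<i> * of_int r / of_nat N))"
      unfolding w_def by (rule exp_of_nat_mult [symmetric])
    also have "of_nat N * (- 2 * of_real pi * \<i> * of_int r / of_nat N)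
        = (of_int (2 * (- r)) * of_real pi) * \<i>"
      using N by (simp add: field_simps)
    also have "exp \<dots> = 1"
      unfolding exp_eq_1 by (auto intro!: exI [where x = "- r"])
    finally show ?thesis .
  qed
  have w1: "w \<noteq> 1"
  proof
    assume "w = 1"
    then obtain k :: int where k: "- (2 * pi * real_of_int r / real N) = real_of_int (2 * k) * pi"
      unfolding w_def exp_eq_1 by auto
    then have "pi * (- real_of_int r) = pi * (real_of_int k * real N)"
      using N by (simp add: field_simps)
    then have "- real_of_int r = real_of_int k * real N"
      using mult_left_cancel pi_neq_zero by blast
    then have "- r = k * int N"
      by (metis of_int_eq_iff of_int_minus of_int_mult of_int_of_nat_eq)
    then have "int N dvd r"
      by (metis dvd_minus_iff dvd_triv_right)
    then show False
      using r zdvd_not_zless by blast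
  qed
  have "ZMod N = int ` {..<N}"
    by (simp add: ZMod_def image_int_atLeastLessThan lessThan_atLeast0)
  then have "(\<Sum>n\<in>ZMod N. indicator (ZMod N) n *
        exp (- 2 * of_real pi * \<i> * of_int r * of_int n / of_nat N)) = (\<Sum>n<N. w ^ n)"
    by (simp add: sum.reindex w_def exp_of_nat_mult [symmetric] mult_ac)
  also have "\<dots> = 0"
    using w1 wN by (simp add: geometric_sum)
  finally show ?thesis
    by (simp add: fourier_coeff_def)
qed

lemma rho4_admissible_le_one:
  assumes "\<alpha> \<le> 1" "rho4_admissible \<alpha> \<rho>"
  shows "\<rho> \<le> 1"
proof (rule field_le_epsilon)
  fix \<epsilon> :: real
  assume \<epsilon>: "\<epsilon> > 0"
  then obtain \<eta> N0 where \<eta>: "\<eta> > 0" and *: "\<And>N A. N \<ge> N0 \<Longrightarrow> 0 < N \<Longrightarrow> A \<subseteq> ZMod N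
      \<Longrightarrow> fourier_uniform \<eta> N A \<Longrightarrow> real (card A) \<ge> (\<alpha> - \<epsilon>) * real N
      \<Longrightarrow> Lambda4 N (indicat_real A) \<ge> \<rho> - \<epsilon>"
    using assms(2) unfolding rho4_admissible_def by meson
  define N where "N = Suc N0"
  have "(\<alpha> - \<epsilon>) * real N \<le> 1 * real N"
    using assms(1) \<epsilon> by (intro mult_right_mono) auto
  moreover have "fourier_uniform \<eta> N (ZMod N)"
    using \<eta> by (simp add: fourier_uniform_def fourier_coeff_ZMod)
  ultimately have "\<rho> - \<epsilon> \<le> Lambda4 N (indicat_real (ZMod N))"
    using * [of N "ZMod N"] by (simp add: N_def ZMod_def)
  also have "\<dots> = 1"
    using AP4_in_ZMod [of N] by (simp add: Lambda4_def N_def, simp add: ZMod_def power2_eq_square)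
  finally show "\<rho> \<le> 1 + \<epsilon>"
    by simp
qed

lemma bdd_above_rho4_admissible: "\<alpha> \<le> 1 \<Longrightarrow> bdd_above {\<rho>. rho4_admissible \<alpha> \<rho>}"
  by (auto intro: bdd_aboveI rho4_admissible_le_one)

lemma rho4_eqI:
  assumes "rho4_admissible \<alpha> \<rho>" "\<And>\<rho>'. rho4_admissible \<alpha> \<rho>' \<Longrightarrow> \<rho>' \<le> \<rho>"
  shows "rho4 \<alpha> = \<rho>"
  unfolding rho4_def using assms by (intro cSup_eq_maximum) auto

end

theory Submission
  imports Defs "HOL-Computational_Algebra.Primes" "HOL-Real_Asymp.Real_Asymp"
begin

text \<open>
  Applying the coloring digit by digit gives an \<open>r\<^sup>k\<close>-coloring of the integers modulo \<open>L = N\<^sup>k\<close>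
  without symmetrically colored progressions. For a large prime \<open>p\<close> let \<open>A\<close> consist of the \<open>n\<close>
  modulo \<open>L p\<close> for which \<open>n\<^sup>2 mod p\<close> lies in an interval depending on the color of \<open>n mod L\<close>. All
  intervals have the same length \<open>h\<close>, so Gauss sums make \<open>A\<close> Fourier uniform of density close to
  \<open>\<delta> = h / p\<close>. The squares \<open>x\<^sub>0, x\<^sub>1, x\<^sub>2, x\<^sub>3\<close> along a progression satisfy
  \<open>x\<^sub>0 + 3 x\<^sub>2 = x\<^sub>3 + 3 x\<^sub>1\<close>, and the intervals are placed so that this identity forces the terms
  \<open>0, 3\<close> and the terms \<open>1, 2\<close> to have equal colors. Hence progressions in \<open>A\<close> have difference
  divisible by \<open>L\<close>, and their density is about at most \<open>\<delta>\<^sup>3 / L\<close>. The intervals can be chosen with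
  \<open>\<delta>\<close> comparable to \<open>r\<^sup>-\<^sup>2\<^sup>k\<close>, and then \<open>1 / L\<close> is comparable to \<open>\<delta>\<close> to the power \<open>1/2 log\<^sub>r N\<close>.
\<close>

section \<open>Residues modulo a product and sums over them\<close>

lemma finite_ZMod [simp]: "finite (ZMod p)"
  by (simp add: ZMod_def)

lemma card_ZMod [simp]: "card (ZMod p) = p"
  by (simp add: ZMod_def)

lemma div_in_ZMod:
  assumes L: "L > 0" and n: "n \<in> ZMod (L * p)"
  shows "n div int L \<in> ZMod p"
proof -
  have "n < int L * int p" "0 \<le> n" using n by (auto simp: ZMod_def)
  moreover have "int L * (n div int L) = n - n mod int L" by (simp add: minus_mod_eq_mult_div)
  moreover have "n mod int L \<ge> 0" using L by simp
  ultimately have "int L * (n div int L) < int L * int p" by linarith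
  then have "n div int L < int p"
    using L by (simp only: mult_less_cancel_left_pos of_nat_0_less_iff)
  then show ?thesis
    using L \<open>0 \<le> n\<close> by (simp add: ZMod_def pos_imp_zdiv_nonneg_iff)
qed

lemma add_mult_in_ZMod:
  assumes "u \<in> ZMod L" "m \<in> ZMod p"
  shows "u + int L * m \<in> ZMod (L * p)"
proof -
  have u: "0 \<le> u" "u < int L" and m: "0 \<le> m" "m + 1 \<le> int p"
    using assms by (auto simp: ZMod_def)
  have "int L * (m + 1) \<le> int L * int p"
    using m by (intro mult_left_mono) auto
  then have "u + int L * m < int L * int p"
    using u by (simp add: algebra_simps)
  then show ?thesis
    using u m by (auto simp: ZMod_def)
qed

lemma sum_ZMod_shift:
  fixes F :: "int \<Rightarrow> 'a::comm_monoid_add"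
  assumes p: "p > 0" and per: "\<And>x. F (x mod int p) = F x"
  shows "(\<Sum>x\<in>ZMod p. F (x + a)) = (\<Sum>x\<in>ZMod p. F x)"
proof (rule sum.reindex_bij_witness [where i = "\<lambda>y. (y - a) mod int p" and j = "\<lambda>x. (x + a) mod int p"])
  fix x assume x: "x \<in> ZMod p"
  show "((x + a) mod int p - a) mod int p = x" "((x - a) mod int p + a) mod int p = x"
    using x by (auto simp: ZMod_def mod_simps)
  show "(x + a) mod int p \<in> ZMod p" "(x - a) mod int p \<in> ZMod p"
    using p by (auto simp: ZMod_def)
  show "F ((x + a) mod int p) = F (x + a)" by (rule per)
qed

text \<open>Fibres over the residue modulo \<open>L\<close>: on a fibre \<open>u\<close> is fixed
  and \<open>m\<close> runs modulo \<open>p\<close>, so sums modulo \<open>L * p\<close> become sums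
  to which arguments modulo a prime apply.\<close>

lemma sum_ZMod_mult:
  fixes F :: "int \<Rightarrow> 'a::comm_monoid_add"
  assumes L: "L > 0"
  shows "(\<Sum>n\<in>ZMod (L * p). F n) = (\<Sum>u\<in>ZMod L. \<Sum>m\<in>ZMod p. F (u + int L * m))"
proof -
  have "(\<Sum>n\<in>ZMod (L * p). F n) = (\<Sum>(u, m)\<in>ZMod L \<times> ZMod p. F (u + int L * m))"
  proof (rule sum.reindex_bij_witness [where i = "\<lambda>(u, m). u + int L * m" and j = "\<lambda>n. (n mod int L, n div int L)"])
    fix n assume n: "n \<in> ZMod (L * p)"
    then show "(n mod int L, n div int L) \<in> ZMod L \<times> ZMod p"
      using L div_in_ZMod [OF L n] by (simp add: ZMod_def)
    show "(case (n mod int L, n div int L) of (u, m) \<Rightarrow> u + int L * m) = n"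
         "(case (n mod int L, n div int L) of (u, m) \<Rightarrow> F (u + int L * m)) = F n"
      by auto
  next
    fix b assume b: "b \<in> ZMod L \<times> ZMod p"
    obtain u m where [simp]: "b = (u, m)" by force
    show "(case b of (u, m) \<Rightarrow> u + int L * m) \<in> ZMod (L * p)"
      using b add_mult_in_ZMod [of u L m p] by simp
    show "((case b of (u, m) \<Rightarrow> u + int L * m) mod int L,
            (case b of (u, m) \<Rightarrow> u + int L * m) div int L) = b"
      using b by (auto simp: ZMod_def)
  qed
  then show ?thesis by (simp add: sum.cartesian_product)
qed

section \<open>Additive characters, bilinear sums and Gauss sums\<close>

definition ep :: "nat \<Rightarrow> int \<Rightarrow> complex" where
  "ep p x = cis (2 * pi * real_of_int x / real p)"

lemma norm_ep [simp]: "norm (ep p x) = 1"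
  by (simp add: ep_def)

lemma ep_0 [simp]: "ep p 0 = 1"
  by (simp add: ep_def)

lemma ep_add: "ep p (x + y) = ep p x * ep p y"
  by (simp add: ep_def cis_mult ring_distribs add_divide_distrib)

lemma cnj_ep: "cnj (ep p x) = ep p (- x)"
  by (simp add: ep_def cis_cnj)

lemma ep_multiple:
  assumes "p > 0"
  shows "ep p (int p * x) = 1"
  using assms cis_multiple_2pi [of "real_of_int x"] by (simp add: ep_def mult.assoc)

lemma ep_eq_1_iff:
  assumes "p > 0"
  shows "ep p x = 1 \<longleftrightarrow> int p dvd x"
proof
  assume "ep p x = 1"
  then have "cos (2 * pi * real_of_int x / real p) = 1"
    by (simp add: ep_def complex_eq_iff)
  then obtain k :: int where "2 * pi * real_of_int x / real p = real_of_int k * 2 * pi"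
    using cos_one_2pi_int by blast
  then have "pi * real_of_int x = pi * (real_of_int k * real p)"
    using assms by (simp add: field_simps)
  then have "real_of_int x = real_of_int (k * int p)"
    by simp
  then have "x = k * int p"
    by (rule of_int_eq_iff [THEN iffD1])
  then show "int p dvd x" by simp
next
  assume "int p dvd x"
  then show "ep p x = 1" using ep_multiple [OF assms] by (auto elim: dvdE)
qed

lemma ep_cong:
  assumes "p > 0" "x mod int p = y mod int p"
  shows "ep p x = ep p y"
proof -
  have "ep p (x - y) = 1"
    using assms by (simp add: ep_eq_1_iff mod_eq_dvd_iff)
  then show ?thesis
    using ep_add [of p "x - y" y] by simp
qed

lemma ep_mult_cancel:
  assumes "L > 0"
  shows "ep (L * p) (int L * x) = ep p x"
proof -
  have "2 * pi * real_of_int (int L * x) / real (L * p) = 2 * pi * real_of_int x / real p"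
    using assms by (simp add: field_simps)
  then show ?thesis by (simp only: ep_def)
qed

text \<open>Orthogonality of characters: if \<open>p\<close> does not divide \<open>a\<close>, the
  shift by \<open>1\<close> multiplies the sum by \<open>ep p a\<close>, which is not
  \<open>1\<close>, so the sum vanishes.\<close>

lemma sum_ep:
  assumes p: "p > 0"
  shows "(\<Sum>x\<in>ZMod p. ep p (a * x)) = (if int p dvd a then of_nat p else 0)"
proof (cases "int p dvd a")
  case True
  then have "ep p (a * x) = 1" for x using p by (simp add: ep_eq_1_iff)
  then show ?thesis using True by simp
next
  case False
  have "(\<Sum>x\<in>ZMod p. ep p (a * (x + 1))) = (\<Sum>x\<in>ZMod p. ep p (a * x))"
    by (rule sum_ZMod_shift) (use p in \<open>auto intro!: ep_cong simp: mod_simps\<close>)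
  moreover have "(\<Sum>x\<in>ZMod p. ep p (a * (x + 1))) = ep p a * (\<Sum>x\<in>ZMod p. ep p (a * x))"
    by (simp add: ring_distribs ep_add sum_distrib_left mult.commute)
  ultimately have "(ep p a - 1) * (\<Sum>x\<in>ZMod p. ep p (a * x)) = 0"
    by (simp add: ring_distribs)
  then show ?thesis
    using False ep_eq_1_iff [OF p] by auto
qed

lemma ZMod_dvd_diff_iff:
  assumes "x \<in> ZMod p" "y \<in> ZMod p"
  shows "int p dvd x - y \<longleftrightarrow> x = y"
  using assms by (auto simp: ZMod_def mod_eq_dvd_iff [symmetric])

text \<open>Opening the square and summing over \<open>x\<close> first leaves only pairs with
  \<open>p\<close> dividing \<open>c * (y - z)\<close>; as \<open>c\<close> is coprime to
  \<open>p\<close>, these are the diagonal ones.\<close>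

lemma parseval_ep:
  fixes h :: "int \<Rightarrow> complex"
  assumes p: "p > 0" and c: "coprime c (int p)"
  shows "(\<Sum>x\<in>ZMod p. (norm (\<Sum>y\<in>ZMod p. h y * ep p (c * x * y)))\<^sup>2)
       = real p * (\<Sum>y\<in>ZMod p. (norm (h y))\<^sup>2)"
proof -
  have 1: "complex_of_real ((norm (\<Sum>y\<in>ZMod p. h y * ep p (c * x * y)))\<^sup>2)
     = (\<Sum>y\<in>ZMod p. \<Sum>z\<in>ZMod p. h y * cnj (h z) * ep p (c * (y - z) * x))" for x
    unfolding complex_norm_square
    by (simp add: sum_product cnj_ep algebra_simps)
      (simp add: ep_add [symmetric] algebra_simps)
  have "complex_of_real (\<Sum>x\<in>ZMod p. (norm (\<Sum>y\<in>ZMod p. h y * ep p (c * x * y)))\<^sup>2)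
     = (\<Sum>x\<in>ZMod p. \<Sum>y\<in>ZMod p. \<Sum>z\<in>ZMod p. h y * cnj (h z) * ep p (c * (y - z) * x))"
    using 1 by simp
  also have "\<dots> = (\<Sum>y\<in>ZMod p. \<Sum>z\<in>ZMod p. \<Sum>x\<in>ZMod p. h y * cnj (h z) * ep p (c * (y - z) * x))"
    by (subst sum.swap, rule sum.cong, simp, rule sum.swap)
  also have "\<dots> = (\<Sum>y\<in>ZMod p. \<Sum>z\<in>ZMod p. h y * cnj (h z) * (if y = z then of_nat p else 0))"
  proof (intro sum.cong refl)
    fix y z assume "y \<in> ZMod p" "z \<in> ZMod p"
    moreover have "int p dvd c * (y - z) \<longleftrightarrow> int p dvd y - z"
      using c by (metis coprime_commute coprime_dvd_mult_right_iff)
    ultimately show "(\<Sum>x\<in>ZMod p. h y * cnj (h z) * ep p (c * (y - z) * x))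
        = h y * cnj (h z) * (if y = z then of_nat p else 0)"
      by (simp add: sum_distrib_left [symmetric] sum_ep [OF p] ZMod_dvd_diff_iff)
  qed
  also have "\<dots> = (\<Sum>y\<in>ZMod p. h y * cnj (h y) * of_nat p)"
    by (simp add: if_distrib [of "(*) _"] sum.delta cong: if_cong)
  also have "\<dots> = complex_of_real (real p * (\<Sum>y\<in>ZMod p. (norm (h y))\<^sup>2))"
    by (simp add: complex_norm_square sum_distrib_left mult_ac del: of_real_power)
  finally show ?thesis
    by (rule of_real_eq_iff [THEN iffD1])
qed

text \<open>The triangle inequality removes \<open>g\<close>, Cauchy-Schwarz passes from the sum of
  \<open>norm (H x)\<close> to the sum of squares, and Parseval evaluates that. This saves a factor
  \<open>sqrt (real p)\<close> over the trivial bound.\<close>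

lemma bilinear_ep_bound:
  fixes g h :: "int \<Rightarrow> complex"
  assumes p: "p > 0" and c: "coprime c (int p)"
    and g: "\<And>x. norm (g x) \<le> 1" and h: "\<And>x. norm (h x) \<le> 1"
  shows "norm (\<Sum>x\<in>ZMod p. \<Sum>y\<in>ZMod p. g x * h y * ep p (c * x * y)) \<le> real p * sqrt (real p)"
proof -
  define H where "H x = (\<Sum>y\<in>ZMod p. h y * ep p (c * x * y))" for x
  have "(\<Sum>x\<in>ZMod p. norm (H x))\<^sup>2 \<le> (\<Sum>x\<in>ZMod p. 1\<^sup>2) * (\<Sum>x\<in>ZMod p. (norm (H x))\<^sup>2)"
    using Cauchy_Schwarz_ineq_sum [of "\<lambda>_. 1" "\<lambda>x. norm (H x)" "ZMod p"] by simp
  also have "\<dots> = real p * (real p * (\<Sum>y\<in>ZMod p. (norm (h y))\<^sup>2))"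
    unfolding H_def by (simp add: parseval_ep [OF p c])
  also have "\<dots> \<le> real p * (real p * (\<Sum>y\<in>ZMod p. 1))"
    by (intro mult_left_mono sum_mono power_le_one) (auto simp: h)
  also have "\<dots> = (real p * sqrt (real p))\<^sup>2"
    by (simp add: power2_eq_square)
  finally have *: "(\<Sum>x\<in>ZMod p. norm (H x)) \<le> real p * sqrt (real p)"
    by (rule power2_le_imp_le) simp
  have "norm (\<Sum>x\<in>ZMod p. \<Sum>y\<in>ZMod p. g x * h y * ep p (c * x * y)) = norm (\<Sum>x\<in>ZMod p. g x * H x)"
    by (simp add: H_def sum_distrib_left mult_ac)
  also have "\<dots> \<le> (\<Sum>x\<in>ZMod p. norm (g x) * norm (H x))"
    by (rule order_trans [OF norm_sum]) (simp add: norm_mult)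
  also have "\<dots> \<le> (\<Sum>x\<in>ZMod p. 1 * norm (H x))"
    by (intro sum_mono mult_right_mono) (auto simp: g)
  finally show ?thesis using * by simp
qed

text \<open>Weyl differencing: substituting \<open>v + w\<close> for \<open>v\<close> in the squared
  modulus makes the phase linear in \<open>w\<close> with coefficient \<open>2 * a * v\<close>.
  Orthogonality then leaves only \<open>v = 0\<close>, which contributes \<open>p\<close>.\<close>

lemma gauss_sum_norm:
  assumes p: "p > 0" and a: "coprime (2 * a) (int p)"
  shows "norm (\<Sum>v\<in>ZMod p. ep p (a * v\<^sup>2 + b * v + c)) = sqrt (real p)"
proof -
  define Q where "Q v = a * v\<^sup>2 + b * v + c" for v
  have per: "ep p (Q (v mod int p) - z) = ep p (Q v - z)" for v z
  proof (rule ep_cong [OF p])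
    have "Q (v mod int p) mod int p = Q v mod int p"
      unfolding Q_def power2_eq_square
      by (rule mod_add_cong [OF mod_add_cong [OF mod_mult_cong [OF refl mod_mult_cong]
            mod_mult_cong [OF refl]] refl]) (rule mod_mod_trivial)+
    then show "(Q (v mod int p) - z) mod int p = (Q v - z) mod int p"
      by (rule mod_diff_cong) simp
  qed
  have "complex_of_real ((norm (\<Sum>v\<in>ZMod p. ep p (Q v)))\<^sup>2) = (\<Sum>w\<in>ZMod p. \<Sum>v\<in>ZMod p. ep p (Q v - Q w))"
    unfolding complex_norm_square
    by (subst sum.swap) (simp add: sum_product cnj_ep ep_add [symmetric])
  also have "\<dots> = (\<Sum>w\<in>ZMod p. \<Sum>v\<in>ZMod p. ep p (Q (v + w) - Q w))"
    using sum_ZMod_shift [where F = "\<lambda>v. ep p (Q v - Q _)", OF p per] by simp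
  also have "\<dots> = (\<Sum>v\<in>ZMod p. \<Sum>w\<in>ZMod p. ep p (a * v\<^sup>2 + b * v) * ep p ((2 * a * v) * w))"
    by (subst sum.swap) (simp add: Q_def ep_add [symmetric] power2_eq_square algebra_simps)
  also have "\<dots> = (\<Sum>v\<in>ZMod p. if v = 0 then of_nat p else 0)"
  proof (intro sum.cong refl)
    fix v assume v: "v \<in> ZMod p"
    have "int p dvd (2 * a) * v \<longleftrightarrow> int p dvd v"
      using a by (metis coprime_commute coprime_dvd_mult_right_iff)
    also have "\<dots> \<longleftrightarrow> v = 0"
      using v ZMod_dvd_diff_iff [of v p 0] p by (auto simp: ZMod_def)
    finally show "(\<Sum>w\<in>ZMod p. ep p (a * v\<^sup>2 + b * v) * ep p ((2 * a * v) * w)) = (if v = 0 then of_nat p else 0)"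
      by (simp add: sum_distrib_left [symmetric] sum_ep [OF p])
  qed
  also have "\<dots> = complex_of_real (real p)"
    using p by (simp add: sum.delta ZMod_def)
  finally have "(norm (\<Sum>v\<in>ZMod p. ep p (Q v)))\<^sup>2 = real p"
    by (rule of_real_eq_iff [THEN iffD1])
  then show ?thesis
    unfolding Q_def by (intro real_sqrt_unique [symmetric]) simp_all
qed

section \<open>Fourier coefficients of intervals\<close>

definition fhat :: "nat \<Rightarrow> int set \<Rightarrow> int \<Rightarrow> complex" where
  "fhat p J t = (\<Sum>y\<in>J. ep p (- (t * y))) / of_nat p"

lemma fhat_0: "fhat p J 0 = of_real (real (card J) / real p)"
  by (simp add: fhat_def)

lemma fhat_inversion:
  assumes p: "p > 0" and J: "J \<subseteq> ZMod p"
  shows "indicator J (x mod int p) = (\<Sum>t\<in>ZMod p. fhat p J t * ep p (t * x))"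
proof -
  have fin: "finite J" using J finite_subset finite_ZMod by blast
  have xm: "x mod int p \<in> ZMod p" using p by (simp add: ZMod_def)
  have "(\<Sum>t\<in>ZMod p. fhat p J t * ep p (t * x)) = (\<Sum>t\<in>ZMod p. \<Sum>y\<in>J. ep p ((x - y) * t)) / of_nat p"
    unfolding fhat_def times_divide_eq_left sum_distrib_right ep_add [symmetric]
      sum_divide_distrib [symmetric] by (simp add: algebra_simps)
  also have "(\<Sum>t\<in>ZMod p. \<Sum>y\<in>J. ep p ((x - y) * t)) = (\<Sum>y\<in>J. if y = x mod int p then of_nat p else 0)"
  proof (subst sum.swap, intro sum.cong refl)
    fix y assume "y \<in> J"
    then have "y mod int p = y" using J by (auto simp: ZMod_def)
    then have "int p dvd x - y \<longleftrightarrow> y = x mod int p"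
      by (metis mod_eq_dvd_iff)
    then show "(\<Sum>t\<in>ZMod p. ep p ((x - y) * t)) = (if y = x mod int p then of_nat p else 0)"
      by (simp add: sum_ep [OF p])
  qed
  also have "\<dots> / of_nat p = indicator J (x mod int p)"
    using fin p by (simp add: sum.delta' indicator_def)
  finally show ?thesis by simp
qed

text \<open>By concavity the sine lies above its chord from \<open>0\<close> to
  \<open>pi / 2\<close>.\<close>

lemma sin_pi_ge:
  assumes "0 \<le> x" "x \<le> 1/2"
  shows "sin (pi * x) \<ge> 2 * x"
proof -
  have "convex_on {0..pi} (\<lambda>x. - sin x)"
    by (rule f''_ge0_imp_convex [where f' = "\<lambda>x. - cos x" and f'' = sin])
      (auto intro!: derivative_eq_intros sin_ge_zero)
  from convex_onD [OF this, of "2 * x" 0 "pi / 2"] assms show ?thesis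
    by (simp add: algebra_simps)
qed

text \<open>This weaker form of the chord bound is symmetric under \<open>x\<close> ->
  \<open>1 - x\<close>, hence valid on the whole unit interval, and its reciprocal splits into two
  partial fractions.\<close>

lemma sin_pi_ge':
  assumes "0 \<le> x" "x \<le> 1"
  shows "sin (pi * x) \<ge> 2 * x * (1 - x)"
proof (cases "x \<le> 1/2")
  case True
  have "2 * x * (1 - x) \<le> 2 * x * 1"
    using assms by (intro mult_left_mono) auto
  then show ?thesis using sin_pi_ge [of x] assms True by simp
next
  case False
  have "2 * (1 - x) * x \<le> 2 * (1 - x) * 1"
    using assms by (intro mult_left_mono) auto
  moreover have "sin (pi * (1 - x)) = sin (pi * x)"
    by (simp add: right_diff_distrib)
  ultimately show ?thesis using sin_pi_ge [of "1 - x"] assms False by (simp add: mult_ac)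
qed

lemma norm_1_minus_cis: "norm (1 - cis (2 * x)) = 2 * \<bar>sin x\<bar>"
proof -
  have "(norm (1 - cis (2 * x)))\<^sup>2 = (1 - cos (2 * x))\<^sup>2 + (sin (2 * x))\<^sup>2"
    by (simp add: cmod_power2)
  also have "\<dots> = 2 - 2 * cos (2 * x)"
    using sin_cos_squared_add [of "2 * x"] by (simp add: power2_eq_square algebra_simps)
  also have "\<dots> = (2 * \<bar>sin x\<bar>)\<^sup>2"
    by (simp add: cos_double_sin power_mult_distrib)
  finally show ?thesis by (rule power2_eq_imp_eq) auto
qed

text \<open>The coefficient is a geometric sum with ratio \<open>w\<close>, so before normalization
  it is at most \<open>2 / norm (1 - w)\<close>, whatever the position and length of the
  interval.\<close>

lemma fhat_interval_bound:
  assumes p: "p > 0" and t: "0 < t" "t < int p"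
  shows "norm (fhat p {a..<a + int h} t) \<le> (1 / of_int t + 1 / (real p - of_int t)) / 2"
proof -
  define x where "x = of_int t / real p"
  define w where "w = ep p (- t)"
  have x: "0 < x" "x < 1" using t p by (auto simp: x_def)
  have "(\<Sum>y\<in>{a..<a + int h}. ep p (- (t * y))) = (\<Sum>i<h. ep p (- (t * (a + int i))))"
    by (rule sum.reindex_bij_witness [where i = "\<lambda>i. a + int i" and j = "\<lambda>y. nat (y - a)"]) auto
  also have "\<dots> = ep p (- (t * a)) * (\<Sum>i<h. w ^ i)"
  proof -
    have w_pow: "w ^ i = ep p (- (t * int i))" for i
      by (induction i) (simp_all add: w_def ep_add [symmetric] algebra_simps)
    have "ep p (- (t * (a + int i))) = ep p (- (t * a)) * w ^ i" for i
      unfolding w_pow ep_add [symmetric] by (simp add: algebra_simps)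
    then show ?thesis by (simp add: sum_distrib_left)
  qed
  finally have s: "norm (\<Sum>y\<in>{a..<a + int h}. ep p (- (t * y))) = norm (\<Sum>i<h. w ^ i)"
    by (simp add: norm_mult)
  have w: "norm (1 - w) = 2 * sin (pi * x)"
  proof -
    have "w = cis (2 * (- (pi * x)))"
      by (simp add: w_def ep_def x_def mult_ac)
    then have "norm (1 - w) = 2 * \<bar>sin (pi * x)\<bar>"
      by (simp only: norm_1_minus_cis sin_minus abs_minus_cancel)
    moreover have "sin (pi * x) \<ge> 0" using x by (intro sin_ge_zero) auto
    ultimately show ?thesis by simp
  qed
  have pos: "0 < 2 * x * (1 - x)" using x by simp
  have sin: "2 * x * (1 - x) \<le> sin (pi * x)" using sin_pi_ge' [of x] x by simp
  have "norm (1 - w) * norm (\<Sum>i<h. w ^ i) = norm (1 - w ^ h)"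
    by (simp add: norm_mult [symmetric] one_diff_power_eq)
  also have "\<dots> \<le> norm (1::complex) + norm (w ^ h)"
    by (rule norm_triangle_ineq4)
  also have "\<dots> = 2" by (simp add: w_def norm_power)
  finally have "sin (pi * x) * norm (\<Sum>i<h. w ^ i) \<le> 1" by (simp add: w)
  moreover have "2 * x * (1 - x) * norm (\<Sum>i<h. w ^ i) \<le> sin (pi * x) * norm (\<Sum>i<h. w ^ i)"
    by (intro mult_right_mono sin) auto
  ultimately have "norm (\<Sum>i<h. w ^ i) \<le> 1 / (2 * x * (1 - x))"
    using pos by (simp add: pos_le_divide_eq mult_ac)
  then have "norm (fhat p {a..<a + int h} t) \<le> 1 / (2 * x * (1 - x)) / real p"
    unfolding fhat_def norm_divide s norm_of_nat by (rule divide_right_mono) simp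
  also have "\<dots> = (1 / of_int t + 1 / (real p - of_int t)) / 2"
    using t p by (simp add: x_def field_simps)
  finally show ?thesis .
qed

text \<open>The reflection \<open>t\<close> -> \<open>int p - t\<close> turns the second fraction
  into the first, so the two halves add up to one harmonic sum. Expanding an interval into
  characters thus costs only a logarithm.\<close>

lemma fhat_interval_l1_bound:
  assumes p: "p > 0"
  shows "(\<Sum>t\<in>ZMod p - {0}. norm (fhat p {a..<a + int h} t)) \<le> harm p"
proof -
  have ZI: "ZMod p - {0} = {1..<int p}" by (auto simp: ZMod_def)
  have "(\<Sum>t\<in>ZMod p - {0}. norm (fhat p {a..<a + int h} t))
     \<le> (\<Sum>t\<in>{1..<int p}. (1 / of_int t + 1 / (real p - of_int t)) / 2)"
    unfolding ZI by (intro sum_mono fhat_interval_bound p) auto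
  also have "\<dots> = ((\<Sum>t\<in>{1..<int p}. 1 / of_int t) + (\<Sum>t\<in>{1..<int p}. 1 / (real p - of_int t))) / 2"
    by (simp add: sum.distrib sum_divide_distrib [symmetric])
  also have "(\<Sum>t\<in>{1..<int p}. 1 / (real p - of_int t)) = (\<Sum>t\<in>{1..<int p}. 1 / real_of_int t)"
    by (rule sum.reindex_bij_witness [where i = "\<lambda>t. int p - t" and j = "\<lambda>t. int p - t"]) auto
  also have "(\<Sum>t\<in>{1..<int p}. 1 / real_of_int t) = (\<Sum>t\<in>{1..<p}. 1 / real t)"
    by (rule sum.reindex_bij_witness [where i = int and j = nat]) auto
  also have "\<dots> \<le> harm p"
    unfolding harm_def by (simp add: divide_inverse) (rule sum_mono2, auto)
  finally show ?thesis by simp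
qed

section \<open>Sets given by quadratic conditions on fibres\<close>

definition quad_set :: "nat \<Rightarrow> nat \<Rightarrow> (int \<Rightarrow> int set) \<Rightarrow> int set" where
  "quad_set L p J = {n \<in> ZMod (L * p). n\<^sup>2 mod int p \<in> J (n mod int L)}"

lemma fourier_coeff_ep:
  "fourier_coeff N f r = (\<Sum>n\<in>ZMod N. f n * ep N (- (r * n))) / of_nat N"
proof -
  have "exp (- 2 * of_real pi * \<i> * of_int r * of_int n / of_nat N) = ep N (- (r * n))" for n
    unfolding ep_def cis_conv_exp by (rule arg_cong [where f = exp]) simp
  then show ?thesis by (simp add: fourier_coeff_def)
qed

lemma fhat_inversion_split:
  assumes p: "p > 0" and J: "J \<subseteq> ZMod p"
  shows "indicator J (x mod int p)
       = of_real (real (card J) / real p) + (\<Sum>t\<in>ZMod p - {0}. fhat p J t * ep p (t * x))"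
proof -
  have "0 \<in> ZMod p" using p by (simp add: ZMod_def)
  then show ?thesis
    unfolding fhat_inversion [OF p J] by (subst sum.remove [of _ 0]) (simp_all add: fhat_0)
qed

text \<open>All intervals have one common length, so the zero frequency is the same on every fibre.
  Coprimality of \<open>p\<close> to \<open>2 * L\<close> keeps
  \<open>t * (u + int L * m)\<^sup>2\<close> a genuinely quadratic phase in \<open>m\<close> for
  every \<open>t\<close> not divisible by \<open>p\<close>.\<close>

locale quadratic_fibres =
  fixes L p h :: nat and a :: "int \<Rightarrow> int"
  assumes L_pos: "L > 0" and prime_p: "prime p" and cop: "coprime (2 * L) p"
    and fibre_subset: "\<And>u. {a u..<a u + int h} \<subseteq> ZMod p"
begin

abbreviation J :: "int \<Rightarrow> int set" where "J u \<equiv> {a u..<a u + int h}"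

text \<open>The error scale: the l1 bound \<open>harm p\<close> for intervals times the modulus
  \<open>1 / sqrt (real p)\<close> of a normalized Gauss sum.\<close>

abbreviation e :: real where "e \<equiv> harm p / sqrt (real p)"

lemma p_pos: "p > 0" using prime_p by (rule prime_gt_0_nat)

lemma coprime_t:
  assumes "t \<in> ZMod p - {0}"
  shows "coprime (2 * (t * (int L)\<^sup>2)) (int p)"
proof -
  have "coprime (int (2 * L)) (int p)" using cop by (simp only: coprime_int_iff)
  then have 1: "coprime 2 (int p)" "coprime (int L) (int p)" by auto
  have "\<not> int p dvd t" using assms by (auto simp: ZMod_def dest: zdvd_imp_le)
  then have "coprime (int p) t"
    using prime_p by (intro prime_imp_coprime) auto
  with 1 show ?thesis by (simp add: coprime_commute)
qed

lemma quad_sum_norm: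
  assumes "t \<in> ZMod p - {0}"
  shows "norm (\<Sum>m\<in>ZMod p. ep p (t * (u + int L * m)\<^sup>2 + b * m)) = sqrt (real p)"
proof -
  have "t * (u + int L * m)\<^sup>2 + b * m = (t * (int L)\<^sup>2) * m\<^sup>2 + (2 * t * u * int L + b) * m + t * u\<^sup>2" for m
    by (simp add: power2_eq_square algebra_simps)
  then show ?thesis
    using gauss_sum_norm [OF p_pos coprime_t [OF assms]] by simp
qed

lemma fhat_l1_mult_le:
  assumes "\<And>t. t \<in> ZMod p - {0} \<Longrightarrow> norm (z t) \<le> B"
  shows "norm (\<Sum>t\<in>ZMod p - {0}. fhat p (J u) t * z t) \<le> harm p * B"
proof -
  have "norm (\<Sum>t\<in>ZMod p - {0}. fhat p (J u) t * z t) \<le> (\<Sum>t\<in>ZMod p - {0}. norm (fhat p (J u) t) * B)"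
    by (intro sum_norm_le) (auto simp: norm_mult intro!: mult_left_mono assms)
  also have "\<dots> \<le> harm p * B"
  proof (cases "B \<ge> 0")
    case True
    then show ?thesis
      unfolding sum_distrib_right [symmetric] by (intro mult_right_mono fhat_interval_l1_bound p_pos)
  next
    case False
    \<comment> \<open>A negative \<open>B\<close> is impossible: it would leave no nonzero
      frequency, yet \<open>1\<close> is one.\<close>
    then have "ZMod p - {0} = {}" using assms norm_ge_zero order_trans by blast
    moreover have "1 \<in> ZMod p - {0}" using prime_gt_1_nat [OF prime_p] by (simp add: ZMod_def)
    ultimately show ?thesis by (metis empty_iff)
  qed
  finally show ?thesis .
qed

lemma mem_quad_set_fibre:
  assumes "u \<in> ZMod L"
  shows "(u + int L * m) mod int (L * p) \<in> quad_set L p J \<longleftrightarrow> (u + int L * m)\<^sup>2 mod int p \<in> J u"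
proof -
  define n where "n = u + int L * m"
  have 1: "n mod int (L * p) \<in> ZMod (L * p)"
    using L_pos p_pos by (simp add: ZMod_def)
  have 2: "n mod int (L * p) mod int L = u"
    using assms by (simp add: mod_mod_cancel n_def ZMod_def)
  have "n mod int (L * p) mod int p = n mod int p"
    by (simp add: mod_mod_cancel)
  then have "(n mod int (L * p))\<^sup>2 mod int p = n\<^sup>2 mod int p"
    by (metis power_mod)
  with 1 2 show ?thesis by (simp add: quad_set_def n_def)
qed

lemma fibre_mem_ZMod:
  assumes "u \<in> ZMod L" "m \<in> ZMod p"
  shows "(u + int L * m) mod int (L * p) = u + int L * m"
  using add_mult_in_ZMod [OF assms] by (simp add: ZMod_def)

text \<open>Compared with the constant density \<open>h / p\<close>, the set deviates on each fibre
  by quadratic phases with nonzero \<open>t\<close>. Twisting by \<open>r\<close> only adds a linear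
  term, so the inner sums remain Gauss sums. Nonzero \<open>r\<close> will give uniformity, and
  \<open>r = 0\<close> the cardinality.\<close>

lemma fourier_coeff_quad_set:
  "norm (fourier_coeff (L * p) (indicator (quad_set L p J)) r
     - of_real (real h / real p) * fourier_coeff (L * p) (indicator (ZMod (L * p))) r) \<le> e"
proof -
  define M where "M = L * p"
  define \<delta> where "\<delta> = complex_of_real (real h / real p)"
  define E where "E n = (indicator (quad_set L p J) n - \<delta> * indicator (ZMod M) n :: complex)" for n
  have E: "E (u + int L * m) = (\<Sum>t\<in>ZMod p - {0}. fhat p (J u) t * ep p (t * (u + int L * m)\<^sup>2))"
    if "u \<in> ZMod L" "m \<in> ZMod p" for u m
  proof -
    have "u + int L * m \<in> ZMod M"
      unfolding M_def by (rule add_mult_in_ZMod [OF that])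
    moreover have "indicator (quad_set L p J) (u + int L * m)
        = (indicator (J u) ((u + int L * m)\<^sup>2 mod int p) :: complex)"
      using mem_quad_set_fibre [OF that(1), of m] fibre_mem_ZMod [OF that] by (simp add: indicator_def)
    ultimately show ?thesis
      by (simp add: E_def \<delta>_def fhat_inversion_split [OF p_pos fibre_subset])
  qed
  have "(\<Sum>n\<in>ZMod M. E n * ep M (- (r * n)))
      = (\<Sum>u\<in>ZMod L. \<Sum>m\<in>ZMod p. E (u + int L * m) * ep M (- (r * (u + int L * m))))"
    unfolding M_def by (rule sum_ZMod_mult [OF L_pos])
  also have "\<dots> = (\<Sum>u\<in>ZMod L. ep M (- (r * u)) * (\<Sum>t\<in>ZMod p - {0}. fhat p (J u) t *
      (\<Sum>m\<in>ZMod p. ep p (t * (u + int L * m)\<^sup>2 + (- r) * m))))" (is "_ = (\<Sum>u\<in>ZMod L. ?G u)")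
  proof (intro sum.cong refl)
    fix u assume u: "u \<in> ZMod L"
    \<comment> \<open>Along a fibre a character modulo \<open>L * p\<close> is a constant times a
      character modulo \<open>p\<close>, because the factor \<open>L\<close> cancels.\<close>
    have "ep M (- (r * (u + int L * m))) = ep M (- (r * u)) * ep p (- r * m)" for m
      unfolding M_def
      by (subst ep_mult_cancel [OF L_pos, symmetric], subst ep_add [symmetric]) (simp add: algebra_simps)
    then have "E (u + int L * m) * ep M (- (r * (u + int L * m)))
        = (\<Sum>t\<in>ZMod p - {0}. ep M (- (r * u)) * (fhat p (J u) t *
             ep p (t * (u + int L * m)\<^sup>2 + (- r) * m)))" if "m \<in> ZMod p" for m
      unfolding E [OF u that] sum_distrib_right by (simp only: ep_add mult_ac)
    then have "(\<Sum>m\<in>ZMod p. E (u + int L * m) * ep M (- (r * (u + int L * m))))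
        = (\<Sum>m\<in>ZMod p. \<Sum>t\<in>ZMod p - {0}. ep M (- (r * u)) * (fhat p (J u) t *
             ep p (t * (u + int L * m)\<^sup>2 + (- r) * m)))"
      by (rule sum.cong [OF refl])
    also have "\<dots> = ?G u"
      by (subst sum.swap) (simp add: sum_distrib_left)
    finally show "(\<Sum>m\<in>ZMod p. E (u + int L * m) * ep M (- (r * (u + int L * m)))) = ?G u" .
  qed
  finally have eq: "(\<Sum>n\<in>ZMod M. E n * ep M (- (r * n))) = (\<Sum>u\<in>ZMod L. ?G u)" .
  have "norm (\<Sum>u\<in>ZMod L. ?G u) \<le> (\<Sum>u\<in>ZMod L. harm p * sqrt (real p))"
    unfolding norm_mult by (intro sum_norm_le)
      (simp only: norm_mult norm_ep mult_1, intro fhat_l1_mult_le eq_refl quad_sum_norm)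
  then have le: "norm (\<Sum>n\<in>ZMod M. E n * ep M (- (r * n))) \<le> real L * (harm p * sqrt (real p))"
    by (simp add: eq)
  have "fourier_coeff M (indicator (quad_set L p J)) r - \<delta> * fourier_coeff M (indicator (ZMod M)) r
      = (\<Sum>n\<in>ZMod M. E n * ep M (- (r * n))) / of_nat M"
    by (simp add: fourier_coeff_ep E_def left_diff_distrib sum_subtractf diff_divide_distrib
        sum_distrib_left mult.assoc)
  also have "norm \<dots> \<le> real L * (harm p * sqrt (real p)) / real M"
    unfolding norm_divide norm_of_nat by (rule divide_right_mono [OF le]) simp
  also have "\<dots> = e"
    using L_pos p_pos by (simp add: M_def real_div_sqrt field_simps)
  finally show ?thesis by (simp add: M_def \<delta>_def)
qed

lemma fourier_uniform_quad_set:
  assumes "e \<le> \<eta>"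
  shows "fourier_uniform \<eta> (L * p) (quad_set L p J)"
  unfolding fourier_uniform_def
proof (intro ballI impI)
  fix r assume "r \<in> ZMod (L * p)" "r \<noteq> 0"
  from fourier_coeff_ZMod [OF this] fourier_coeff_quad_set [of r] assms
  show "norm (fourier_coeff (L * p) (indicator (quad_set L p J)) r) \<le> \<eta>" by simp
qed

lemma card_quad_set: "real (card (quad_set L p J)) \<ge> (real h / real p - e) * real (L * p)"
proof -
  define A where "A = quad_set L p J"
  have sub: "A \<subseteq> ZMod (L * p)" by (auto simp: A_def quad_set_def)
  have "fourier_coeff (L * p) (indicator A) 0 = of_real (real (card A) / real (L * p))"
    using sub by (simp add: fourier_coeff_ep sum.If_cases indicator_def Int_absorb1 flip: Int_def)
  moreover have "fourier_coeff (L * p) (indicator (ZMod (L * p))) 0 = 1"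
    using L_pos p_pos by (simp add: fourier_coeff_ep)
  ultimately have "\<bar>real (card A) / real (L * p) - real h / real p\<bar> \<le> e"
    using fourier_coeff_quad_set [of 0] unfolding A_def [symmetric]
    by (metis mult.right_neutral norm_of_real of_real_diff)
  then have "real h / real p - e \<le> real (card A) / real (L * p)"
    by linarith
  then show ?thesis
    using L_pos p_pos unfolding A_def by (subst (asm) pos_le_divide_eq) simp_all
qed

lemma fibre_sum_norm:
  "norm (\<Sum>m\<in>ZMod p. indicator (J u) ((u + int L * m)\<^sup>2 mod int p) :: complex) \<le> real p * (real h / real p + e)"
proof -
  have "(\<Sum>m\<in>ZMod p. indicator (J u) ((u + int L * m)\<^sup>2 mod int p) :: complex)
      = of_nat p * of_real (real h / real p)
        + (\<Sum>t\<in>ZMod p - {0}. fhat p (J u) t * (\<Sum>m\<in>ZMod p. ep p (t * (u + int L * m)\<^sup>2 + 0 * m)))"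
    by (simp add: fhat_inversion_split [OF p_pos fibre_subset] sum.distrib sum_distrib_left
        sum.swap [of _ "ZMod p - {0}"])
  also have "norm \<dots> \<le> real h + harm p * sqrt (real p)"
    by (rule norm_triangle_mono [OF _ fhat_l1_mult_le]) (use p_pos in \<open>simp_all only: quad_sum_norm, auto\<close>)
  also have "\<dots> = real p * (real h / real p + e)"
    using p_pos by (simp add: field_simps)
  finally show ?thesis .
qed

text \<open>Three terms of a progression inside a fibre behave as if independent. Only the third
  indicator is expanded: its zero frequency yields the main term. With \<open>y = m + w\<close> the
  third term sits at \<open>2 * y - m\<close>, whose square contains a product \<open>m * y\<close>,
  so each other frequency gives a bilinear sum.\<close>

lemma fibre_triple_sum:
  fixes f :: "int \<Rightarrow> int \<Rightarrow> real"
  defines "f \<equiv> \<lambda>u m. indicator (J u) ((u + int L * m)\<^sup>2 mod int p)"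
  shows "(\<Sum>m\<in>ZMod p. \<Sum>w\<in>ZMod p. f u m * f u (m + w) * f u (m + 2 * w))
       \<le> (real p)\<^sup>2 * (real h / real p * (real h / real p + e)\<^sup>2 + e)"
proof -
  define F :: "int \<Rightarrow> complex" where "F m = indicator (J u) ((u + int L * m)\<^sup>2 mod int p)" for m
  define \<delta> where "\<delta> = real h / real p"
  have fF: "complex_of_real (f u m) = F m" for m
    by (simp add: f_def F_def indicator_def)
  have F_le: "norm (F m) \<le> 1" for m by (simp add: F_def indicator_def)
  have F_cong: "F x = F y" if "x mod int p = y mod int p" for x y
  proof -
    have "(u + int L * x) mod int p = (u + int L * y) mod int p"
      using that by (intro mod_add_cong mod_mult_cong) auto
    then have "(u + int L * x)\<^sup>2 mod int p = (u + int L * y)\<^sup>2 mod int p"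
      by (metis power_mod)
    then show ?thesis by (simp add: F_def)
  qed
  have shift: "(\<Sum>w\<in>ZMod p. F m * F (w + m) * F (2 * (w + m) - m)) = (\<Sum>y\<in>ZMod p. F m * F y * F (2 * y - m))" for m
  proof (rule sum_ZMod_shift [where F = "\<lambda>y. F m * F y * F (2 * y - m)", OF p_pos])
    fix x
    have "(2 * (x mod int p) - m) mod int p = (2 * x - m) mod int p"
      by (intro mod_diff_cong) (simp_all add: mod_mult_right_eq)
    then have "F (2 * (x mod int p) - m) = F (2 * x - m)" by (rule F_cong)
    moreover have "F (x mod int p) = F x" by (rule F_cong) simp
    ultimately show "F m * F (x mod int p) * F (2 * (x mod int p) - m) = F m * F x * F (2 * x - m)"
      by simp
  qed
  \<comment> \<open>\<open>g\<close> and \<open>k\<close> absorb the parts of the phase in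
    \<open>m\<close> alone and in \<open>y\<close> alone; their moduli are at most \<open>1\<close>,
    and only the mixed term is left.\<close>
  define g where "g t m = F m * ep p (t * ((int L * m)\<^sup>2 - 2 * u * int L * m))" for t m
  define k where "k t y = F y * ep p (t * (u + 2 * int L * y)\<^sup>2)" for t y
  have exp: "F m * F y * F (2 * y - m) = of_real \<delta> * (F m * F y)
      + (\<Sum>t\<in>ZMod p - {0}. fhat p (J u) t * (g t m * k t y * ep p ((- (4 * t * (int L)\<^sup>2)) * m * y)))" for m y
  proof -
    have "F m * F y * ep p (t * (u + int L * (2 * y - m))\<^sup>2)
        = g t m * k t y * ep p ((- (4 * t * (int L)\<^sup>2)) * m * y)" for t
    proof -
      have "t * (u + int L * (2 * y - m))\<^sup>2 = t * ((int L * m)\<^sup>2 - 2 * u * int L * m)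
          + t * (u + 2 * int L * y)\<^sup>2 + (- (4 * t * (int L)\<^sup>2)) * m * y"
        by (simp add: power2_eq_square algebra_simps)
      then show ?thesis by (simp only: g_def k_def ep_add mult_ac)
    qed
    then have "F m * F y * (fhat p (J u) t * ep p (t * (u + int L * (2 * y - m))\<^sup>2))
        = fhat p (J u) t * (g t m * k t y * ep p ((- (4 * t * (int L)\<^sup>2)) * m * y))" for t
      by (metis mult.left_commute)
    note 1 = this
    have 2: "F (2 * y - m) = of_real \<delta> + (\<Sum>t\<in>ZMod p - {0}. fhat p (J u) t * ep p (t * (u + int L * (2 * y - m))\<^sup>2))"
      unfolding F_def fhat_inversion_split [OF p_pos fibre_subset] by (simp add: \<delta>_def)
    show ?thesis
      by (simp only: 1 2 distrib_left sum_distrib_left mult.commute [of "F m * F y" "of_real \<delta>"])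
  qed
  have "complex_of_real (\<Sum>m\<in>ZMod p. \<Sum>w\<in>ZMod p. f u m * f u (m + w) * f u (m + 2 * w))
      = (\<Sum>m\<in>ZMod p. \<Sum>w\<in>ZMod p. F m * F (w + m) * F (2 * (w + m) - m))"
    by (simp add: fF algebra_simps)
  also have "\<dots> = (\<Sum>m\<in>ZMod p. \<Sum>y\<in>ZMod p. F m * F y * F (2 * y - m))"
    by (simp only: shift)
  also have "\<dots> = of_real \<delta> * (\<Sum>m\<in>ZMod p. F m)\<^sup>2 + (\<Sum>t\<in>ZMod p - {0}. fhat p (J u) t *
      (\<Sum>m\<in>ZMod p. \<Sum>y\<in>ZMod p. g t m * k t y * ep p ((- (4 * t * (int L)\<^sup>2)) * m * y)))"
  proof -
    have "(\<Sum>m\<in>ZMod p. \<Sum>y\<in>ZMod p. of_real \<delta> * (F m * F y)) = of_real \<delta> * (\<Sum>m\<in>ZMod p. F m)\<^sup>2"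
      by (simp only: power2_eq_square sum_product) (simp only: sum_distrib_left)
    moreover have "(\<Sum>m\<in>ZMod p. \<Sum>y\<in>ZMod p. \<Sum>t\<in>T. c t * X t m y)
        = (\<Sum>t\<in>T. c t * (\<Sum>m\<in>ZMod p. \<Sum>y\<in>ZMod p. X t m y))"
      for T and c :: "int \<Rightarrow> complex" and X
      by (simp only: sum.swap [of _ T] sum_distrib_left)
    ultimately show ?thesis
      by (simp only: exp sum.distrib)
  qed
  finally have eq: "complex_of_real (\<Sum>m\<in>ZMod p. \<Sum>w\<in>ZMod p. f u m * f u (m + w) * f u (m + 2 * w)) = \<dots>" .
  have bil: "norm (\<Sum>m\<in>ZMod p. \<Sum>y\<in>ZMod p. g t m * k t y * ep p ((- (4 * t * (int L)\<^sup>2)) * m * y))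
      \<le> real p * sqrt (real p)" if t: "t \<in> ZMod p - {0}" for t
  proof (rule bilinear_ep_bound [OF p_pos])
    show "coprime (- (4 * t * (int L)\<^sup>2)) (int p)"
    proof -
      have "coprime (2 * (2 * (t * (int L)\<^sup>2))) (int p)"
        using coprime_t [OF t] by (simp only: coprime_mult_left_iff simp_thms)
      moreover have "2 * (2 * (t * (int L)\<^sup>2)) = 4 * t * (int L)\<^sup>2" by simp
      ultimately show ?thesis by (simp only: coprime_minus_left_iff)
    qed
  qed (auto simp: g_def k_def norm_mult F_le)
  have "(\<Sum>m\<in>ZMod p. \<Sum>w\<in>ZMod p. f u m * f u (m + w) * f u (m + 2 * w))
      \<le> norm (complex_of_real (\<Sum>m\<in>ZMod p. \<Sum>w\<in>ZMod p. f u m * f u (m + w) * f u (m + 2 * w)))"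
    unfolding norm_of_real by (rule abs_ge_self)
  also have "\<dots> \<le> \<delta> * (real p * (\<delta> + e))\<^sup>2 + harm p * (real p * sqrt (real p))"
    unfolding eq
  proof (rule norm_triangle_mono [OF _ fhat_l1_mult_le])
    have "norm (\<Sum>m\<in>ZMod p. F m) \<le> real p * (\<delta> + e)"
      unfolding F_def \<delta>_def by (rule fibre_sum_norm)
    then show "norm (of_real \<delta> * (\<Sum>m\<in>ZMod p. F m)\<^sup>2) \<le> \<delta> * (real p * (\<delta> + e))\<^sup>2"
      unfolding norm_mult norm_power norm_of_real
      by (intro mult_mono power_mono) (auto simp: \<delta>_def)
  qed (rule bil)
  also have "\<dots> = (real p)\<^sup>2 * (\<delta> * (\<delta> + e)\<^sup>2 + e)"
    using p_pos by (simp add: power_mult_distrib field_simps power2_eq_square)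
  finally show ?thesis by (simp add: \<delta>_def)
qed

text \<open>Only the \<open>p\<close> differences divisible by \<open>L\<close> survive out of
  \<open>L * p\<close>, which gives the factor \<open>1 / L\<close>. Their progressions stay in one
  fibre, where the fourth indicator is bounded by \<open>1\<close> and the triple count
  applies.\<close>

lemma Lambda4_quad_set:
  defines "A \<equiv> quad_set L p J"
  assumes no_AP: "\<And>n d. \<lbrakk>\<forall>i<4. AP4 (L * p) n d i \<in> A\<rbrakk> \<Longrightarrow> d mod int L = 0"
  shows "Lambda4 (L * p) (indicat_real A)
       \<le> (real h / real p * (real h / real p + e)\<^sup>2 + e) / real L"
proof -
  define M where "M = L * p"
  define P where "P n d = indicat_real A (AP4 M n d 0) * indicat_real A (AP4 M n d 1)
      * indicat_real A (AP4 M n d 2) * indicat_real A (AP4 M n d 3)" for n d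
  define f :: "int \<Rightarrow> int \<Rightarrow> real" where "f u m = indicator (J u) ((u + int L * m)\<^sup>2 mod int p)" for u m
  define B where "B = real h / real p * (real h / real p + e)\<^sup>2 + e"
  have P_0: "P n (\<epsilon> + int L * w) = 0" if "\<epsilon> \<in> ZMod L - {0}" for n \<epsilon> w
  proof (rule ccontr)
    assume "P n (\<epsilon> + int L * w) \<noteq> 0"
    then have "\<forall>i<4. AP4 M n (\<epsilon> + int L * w) i \<in> A"
      by (auto simp: P_def indicator_def eval_nat_numeral less_Suc_eq)
    from no_AP [OF this [unfolded M_def]] that show False
      by (simp add: ZMod_def)
  qed
  have zero: "(0::int) \<in> ZMod L" using L_pos by (simp add: ZMod_def)
  have P_le: "P (u + int L * m) (int L * w) \<le> f u m * f u (m + w) * f u (m + 2 * w)"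
    if "u \<in> ZMod L" for u m w
  proof -
    have *: "indicat_real A (AP4 M (u + int L * m) (int L * w) i) = f u (m + int i * w)" for i
    proof -
      have "AP4 M (u + int L * m) (int L * w) i = (u + int L * (m + int i * w)) mod int (L * p)"
        by (simp add: AP4_def M_def algebra_simps)
      then show ?thesis
        using mem_quad_set_fibre [OF that] by (simp add: f_def A_def indicator_def)
    qed
    show ?thesis
      unfolding P_def * by (simp add: f_def indicator_def)
  qed
  have "(\<Sum>n\<in>ZMod M. \<Sum>d\<in>ZMod M. P n d) = (\<Sum>n\<in>ZMod M. \<Sum>w\<in>ZMod p. P n (int L * w))"
  proof (rule sum.cong [OF refl])
    fix n
    have "(\<Sum>d\<in>ZMod M. P n d) = (\<Sum>\<epsilon>\<in>ZMod L. \<Sum>w\<in>ZMod p. P n (\<epsilon> + int L * w))"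
      unfolding M_def by (rule sum_ZMod_mult [OF L_pos])
    also have "\<dots> = (\<Sum>w\<in>ZMod p. P n (int L * w))"
      by (subst sum.remove [OF _ zero]) (simp_all add: P_0)
    finally show "(\<Sum>d\<in>ZMod M. P n d) = (\<Sum>w\<in>ZMod p. P n (int L * w))" .
  qed
  also have "\<dots> = (\<Sum>u\<in>ZMod L. \<Sum>m\<in>ZMod p. \<Sum>w\<in>ZMod p. P (u + int L * m) (int L * w))"
    unfolding M_def by (rule sum_ZMod_mult [OF L_pos])
  also have "\<dots> \<le> (\<Sum>u\<in>ZMod L. (real p)\<^sup>2 * B)"
  proof (rule sum_mono)
    fix u assume u: "u \<in> ZMod L"
    have "(\<Sum>m\<in>ZMod p. \<Sum>w\<in>ZMod p. P (u + int L * m) (int L * w))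
        \<le> (\<Sum>m\<in>ZMod p. \<Sum>w\<in>ZMod p. f u m * f u (m + w) * f u (m + 2 * w))"
      by (intro sum_mono P_le u)
    also have "\<dots> \<le> (real p)\<^sup>2 * B"
      unfolding f_def B_def by (rule fibre_triple_sum)
    finally show "(\<Sum>m\<in>ZMod p. \<Sum>w\<in>ZMod p. P (u + int L * m) (int L * w)) \<le> (real p)\<^sup>2 * B" .
  qed
  finally have "(\<Sum>n\<in>ZMod M. \<Sum>d\<in>ZMod M. P n d) \<le> real L * ((real p)\<^sup>2 * B)" by simp
  then have "Lambda4 M (indicat_real A) \<le> real L * ((real p)\<^sup>2 * B) / (real M)\<^sup>2"
    unfolding Lambda4_def P_def by (rule divide_right_mono) simp
  also have "\<dots> = B / real L"
    using L_pos p_pos by (simp add: M_def power2_eq_square)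
  finally show ?thesis by (simp add: M_def B_def)
qed

end

section \<open>Products and powers of colorings\<close>

lemma AP4_mod: "L dvd M \<Longrightarrow> AP4 M n d k mod int L = AP4 L (n mod int L) (d mod int L) k"
  unfolding AP4_def
  by (simp only: mod_mod_cancel of_nat_dvd_iff mod_add_left_eq)
    (rule mod_add_cong [OF refl], simp only: mod_mult_right_eq)

text \<open>
  If the lowest digit of the difference vanishes, the lowest digit is constant along the
  progression and there are no carries, so the higher digits form a progression themselves.
\<close>

lemma product_coloring:
  assumes N: "N > 0" "N' > 0"
    and c: "coloring r N c" "\<not> has_symmetric_4AP N c"
    and c': "coloring r' N' c'" "\<not> has_symmetric_4AP N' c'"
  defines "b \<equiv> \<lambda>n. c (n mod int N) + r * c' (n div int N)"
  shows "coloring (r * r') (N * N') b" and "\<not> has_symmetric_4AP (N * N') b"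
proof -
  have ZN: "n mod int N \<in> ZMod N" for n using N by (simp add: ZMod_def)
  have ZN': "n div int N \<in> ZMod N'" if "n \<in> ZMod (N * N')" for n
    using N(1) that by (rule div_in_ZMod)
  have cr: "c (n mod int N) < r" for n using c(1) ZN by (auto simp: coloring_def)
  have cr': "c' (n div int N) < r'" if "n \<in> ZMod (N * N')" for n
    using c'(1) ZN' [OF that] by (auto simp: coloring_def)
  show "coloring (r * r') (N * N') b"
    unfolding coloring_def
  proof
    fix n assume n: "n \<in> ZMod (N * N')"
    have "r * Suc (c' (n div int N)) \<le> r * r'"
      using cr' [OF n] by (intro mult_le_mono2) simp
    then show "b n < r * r'" using cr [of n] by (simp add: b_def)
  qed
  have b_eq: "c (x mod int N) = c (y mod int N) \<and> c' (x div int N) = c' (y div int N)" if "b x = b y" for x y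
  proof -
    \<comment> \<open>The lower digit \<open>c\<close> is below \<open>r\<close>, so the product
      color determines both colors.\<close>
    have "b z mod r = c (z mod int N)" "b z div r = c' (z div int N)" for z
      using cr [of z] by (auto simp: b_def)
    with that show ?thesis by metis
  qed
  show "\<not> has_symmetric_4AP (N * N') b"
  proof
    assume "has_symmetric_4AP (N * N') b"
    then obtain n d where n: "n \<in> ZMod (N * N')" and d: "d \<in> ZMod (N * N')" "d \<noteq> 0"
      and s: "b (AP4 (N * N') n d 0) = b (AP4 (N * N') n d 3)"
             "b (AP4 (N * N') n d 1) = b (AP4 (N * N') n d 2)"
      by (auto simp: has_symmetric_4AP_def symmetrically_colored_def)
    show False
    proof (cases "d mod int N = 0")
      case False
      have "symmetrically_colored N c (n mod int N) (d mod int N)"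
        using s [THEN b_eq] by (simp add: symmetrically_colored_def AP4_mod)
      then show False
        using c(2) False ZN unfolding has_symmetric_4AP_def by blast
    next
      case True
      have div: "AP4 (N * N') n d k div int N = AP4 N' (n div int N) (d div int N) k" for k
      proof -
        obtain d' where d': "d = int N * d'" using True by auto
        have "n + int k * d = n mod int N + int N * (n div int N + int k * d')"
          by (simp add: d' algebra_simps)
        then have "(n + int k * d) div int N = n div int N + int k * d'"
          using N by simp
        moreover have "x mod (int N * int N') div int N = x div int N mod int N'" for x
          using N by (subst zmod_zmult2_eq) auto
        ultimately show ?thesis
          using N by (simp add: AP4_def d')
      qed
      have "symmetrically_colored N' c' (n div int N) (d div int N)"
        using s [THEN b_eq] by (simp add: symmetrically_colored_def div)
      moreover have "d div int N \<noteq> 0" using True d by auto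
      ultimately show False
        using c'(2) ZN' n d unfolding has_symmetric_4AP_def by blast
    qed
  qed
qed

lemma power_coloring:
  assumes "N > 0" "coloring r N c" "\<not> has_symmetric_4AP N c"
  shows "\<exists>b. coloring (r ^ k) (N ^ k) b \<and> \<not> has_symmetric_4AP (N ^ k) b"
proof (induction k)
  case 0
  \<comment> \<open>Modulo \<open>1\<close> there is no nonzero difference, so a single color
    suffices.\<close>
  have "coloring 1 1 (\<lambda>_. 0)" "\<not> has_symmetric_4AP 1 (\<lambda>_. 0)"
    by (auto simp: coloring_def has_symmetric_4AP_def ZMod_def)
  then show ?case by auto
next
  case (Suc k)
  then obtain b where "coloring (r ^ k) (N ^ k) b" "\<not> has_symmetric_4AP (N ^ k) b" by blast
  from product_coloring [OF _ _ assms(2,3) this] assms(1) show ?case by auto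
qed

section \<open>Digit spreading and the decoding of sums\<close>

text \<open>
  Base 3 digits are reread in base 9, so that a sum \<open>s + 3 s'\<close> of two such numbers determines
  both of them and the sums still fill an interval; embedding \<open>R\<close> colors costs only \<open>O(R\<^sup>2)\<close>.
\<close>

fun spread :: "nat \<Rightarrow> nat" where
  "spread n = (if n = 0 then 0 else n mod 3 + 9 * spread (n div 3))"

declare spread.simps [simp del]

lemma spread_rec: "spread n = n mod 3 + 9 * spread (n div 3)"
  by (cases "n = 0") (simp_all add: spread.simps)

text \<open>The extreme case has all digits \<open>2\<close> and value (9^j - 1) / 4. The factor
  \<open>4\<close> is what keeps \<open>spread a + 3 * spread b\<close> below
  \<open>9 ^ j\<close>.\<close>

lemma spread_bound:
  assumes "n < 3 ^ j"
  shows "4 * spread n < 9 ^ j"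
  using assms
proof (induction j arbitrary: n)
  case 0
  then show ?case by (simp add: spread.simps)
next
  case (Suc j)
  have "4 * spread (n div 3) < 9 ^ j"
    using Suc.prems by (intro Suc.IH) (simp add: less_mult_imp_div_less mult.commute)
  then show ?case
    using spread_rec [of n] by simp
qed

text \<open>The lowest base 9 digit of the sum is \<open>a mod 3 + 3 * (b mod 3)\<close>, at most
  \<open>8\<close>, so nothing is carried and both lowest digits can be read off. The quotients by
  \<open>3\<close> satisfy the same equation.\<close>

lemma spread_inj:
  assumes "spread a + 3 * spread b = spread a' + 3 * spread b'"
  shows "a = a' \<and> b = b'"
  using assms
proof (induction "a + b + a' + b'" arbitrary: a b a' b' rule: less_induct)
  case less
  have digits: "x = x' \<and> y = y' \<and> z = z'"
    if "x + 3 * y + 9 * z = x' + 3 * y' + 9 * z'" "x < 3" "y < 3" "x' < 3" "y' < 3" for x y x' y' z z' :: nat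
  proof -
    have "u = (u + 3 * v + 9 * w) mod 3" if "u < 3" for u v w :: nat
    proof -
      have "u + 3 * v + 9 * w = u + 3 * (v + 3 * w)" by simp
      then show ?thesis using that by (metis mod_less mod_mult_self2)
    qed
    moreover have "z = (x + 3 * y + 9 * z) div 9" "z' = (x' + 3 * y' + 9 * z') div 9"
      using that(2-) by auto
    ultimately have "x = x'" "z = z'" using that(1-4) by metis+
    with that(1) show ?thesis by simp
  qed
  have eq: "a mod 3 + 3 * (b mod 3) + 9 * (spread (a div 3) + 3 * spread (b div 3))
      = a' mod 3 + 3 * (b' mod 3) + 9 * (spread (a' div 3) + 3 * spread (b' div 3))"
  proof -
    have "x mod 3 + 3 * (y mod 3) + 9 * (spread (x div 3) + 3 * spread (y div 3)) = spread x + 3 * spread y" for x y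
      unfolding spread_rec [of x] spread_rec [of y] by (simp only: distrib_left mult.left_commute add_ac)
    then show ?thesis using less.prems by (simp only:)
  qed
  then have m: "a mod 3 = a' mod 3" "b mod 3 = b' mod 3"
    and s: "spread (a div 3) + 3 * spread (b div 3) = spread (a' div 3) + 3 * spread (b' div 3)"
    using digits [OF eq] by simp_all
  show ?case
  \<comment> \<open>Division by \<open>3\<close> decreases the measure unless all four numbers
    vanish.\<close>
  proof (cases "a + b + a' + b' = 0")
    case False
    then have "a div 3 + b div 3 + a' div 3 + b' div 3 < a + b + a' + b'"
      using times_div_less_eq_dividend [of 3 a] times_div_less_eq_dividend [of 3 b]
        times_div_less_eq_dividend [of 3 a'] times_div_less_eq_dividend [of 3 b'] by linarith
    from less.hyps [OF this s] have "a div 3 = a' div 3" "b div 3 = b' div 3" by auto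
    moreover have "x = y" if "x div 3 = y div 3" "x mod 3 = y mod 3" for x y :: nat
      using that by (metis div_mult_mod_eq)
    ultimately show ?thesis using m by blast
  qed simp
qed

text \<open>Harmonic numbers grow like the logarithm; hence the error scale of the construction
  vanishes for large primes.\<close>

lemma harm_over_sqrt_tendsto_0: "(\<lambda>n. harm n / sqrt (real n)) \<longlonglongrightarrow> 0"
proof -
  have "(\<lambda>n. inverse (sqrt (real n))) \<longlonglongrightarrow> 0" "(\<lambda>n. ln (real n) / sqrt (real n)) \<longlonglongrightarrow> 0"
    by real_asymp+
  from tendsto_add [OF tendsto_mult [OF euler_mascheroni_LIMSEQ this(1)] this(2)]
  show ?thesis by (simp add: divide_inverse left_diff_distrib)
qed

section \<open>Placement of the intervals\<close>

text \<open>
  The spacing \<open>4 h\<close> exceeds \<open>y + 3 y'\<close> for all offsets \<open>y, y' < h\<close>, so that \<open>x + 3 x'\<close> determines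
  the colors of \<open>x\<close> and \<open>x'\<close>.
\<close>

definition fibre_start :: "nat \<Rightarrow> nat \<Rightarrow> (int \<Rightarrow> nat) \<Rightarrow> int \<Rightarrow> int" where
  "fibre_start L h b u = int (4 * h * spread (b (u mod int L)))"

text \<open>With \<open>R \<le> 3 ^ j\<close> the spread colors stay below 9^j / 4, and the choice
  of \<open>h\<close> makes every sum x + 3 x' of interval elements smaller than
  \<open>p\<close>.\<close>

context
  fixes L p j R :: nat and b :: "int \<Rightarrow> nat" and h :: nat
  assumes L_pos: "L > 0" and prime_p: "prime p" and cop: "coprime (2 * L) p"
    and b: "coloring R L b" "\<not> has_symmetric_4AP L b" and R: "R \<le> 3 ^ j"
  defines "h \<equiv> p div (4 * 9 ^ j)"
begin

lemma spread_b: "4 * spread (b (u mod int L)) < 9 ^ j"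
proof (rule spread_bound)
  have "u mod int L \<in> ZMod L" using L_pos by (simp add: ZMod_def)
  then show "b (u mod int L) < 3 ^ j"
    using b(1) R by (auto simp: coloring_def intro: less_le_trans)
qed

lemma h_le: "h * (4 * 9 ^ j) \<le> p"
  unfolding h_def by (rule div_times_less_eq_dividend)

lemma quadratic_fibres_start: "quadratic_fibres L p h (fibre_start L h b)"
proof
  fix u
  define s where "s = spread (b (u mod int L))"
  have "h * (4 * s + 1) \<le> h * (4 * 9 ^ j)"
    using spread_b [of u] by (intro mult_le_mono) (auto simp: s_def)
  with h_le have "h * (4 * s + 1) \<le> p" by (rule order_trans [rotated])
  then have "int (h * (4 * s + 1)) \<le> int p" by (simp only: of_nat_le_iff)
  then show "{fibre_start L h b u..<fibre_start L h b u + int h} \<subseteq> ZMod p"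
    unfolding s_def by (auto simp: fibre_start_def ZMod_def algebra_simps)
qed (use L_pos prime_p cop in auto)

interpretation quadratic_fibres L p h "fibre_start L h b"
  by (rule quadratic_fibres_start)

text \<open>A congruence between two sums below \<open>p\<close> is an equality. Division by the
  spacing \<open>4 * int h\<close> strips the offsets \<open>y\<close> and leaves an equation of
  spread colors, which decodes to a symmetric coloring modulo \<open>L\<close>.\<close>

lemma AP4_quad_set_imp:
  assumes "\<forall>i<4. AP4 (L * p) n d i \<in> quad_set L p J"
  shows "d mod int L = 0"
proof (rule ccontr)
  assume d: "d mod int L \<noteq> 0"
  define q where "q i = b (AP4 L (n mod int L) (d mod int L) i)" for i
  define x where "x i = (n + int i * d)\<^sup>2 mod int p" for i
  define y where "y i = x i - int (4 * h * spread (q i))" for i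
  have xJ: "x i \<in> J (AP4 L (n mod int L) (d mod int L) i)" if "i < 4" for i
  proof -
    have "(AP4 (L * p) n d i)\<^sup>2 mod int p = x i"
      unfolding AP4_def x_def by (metis mod_mod_cancel of_nat_dvd_iff dvd_triv_right power_mod)
    moreover have "AP4 (L * p) n d i mod int L = AP4 L (n mod int L) (d mod int L) i"
      by (rule AP4_mod) simp
    ultimately show ?thesis using assms that by (auto simp: quad_set_def)
  qed
  have q_eq: "b (AP4 L (n mod int L) (d mod int L) i mod int L) = q i" for i
    by (simp add: q_def AP4_def)
  have y: "0 \<le> y i" "y i < int h" if "i < 4" for i
    using xJ [OF that] unfolding y_def fibre_start_def q_eq by auto
  \<comment> \<open>A point of the interval shows that it is nonempty, so \<open>4 * int h\<close>
    can serve as a divisor.\<close>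
  then have h_pos: "0 < int h" using y [of 0] by linarith
  have sum_eq: "x i + 3 * x k = (4 * int h) * int (spread (q i) + 3 * spread (q k)) + (y i + 3 * y k)" for i k
    by (simp add: y_def algebra_simps)
  have sum_less: "x i + 3 * x k < int p" and sum_nonneg: "0 \<le> x i + 3 * x k"
    and sum_div: "(x i + 3 * x k) div (4 * int h) = int (spread (q i) + 3 * spread (q k))"
    if "i < 4" "k < 4" for i k
  proof -
    have "4 * spread (q i) < 9 ^ j" for i
      using spread_b [of "AP4 L (n mod int L) (d mod int L) i"] unfolding q_eq .
    from this [of i] this [of k] have "spread (q i) + 3 * spread (q k) + 1 \<le> 9 ^ j" by linarith
    then have "4 * h * (spread (q i) + 3 * spread (q k) + 1) \<le> 4 * h * 9 ^ j"
      by (intro mult_le_mono2)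
    also have "\<dots> \<le> p" using h_le by (simp add: mult_ac)
    finally have "int (4 * h * (spread (q i) + 3 * spread (q k) + 1)) \<le> int p"
      by (simp only: of_nat_le_iff)
    then have "(4 * int h) * int (spread (q i) + 3 * spread (q k)) + 4 * int h \<le> int p"
      by (simp add: algebra_simps)
    moreover have ys: "y i + 3 * y k < 4 * int h" "0 \<le> y i + 3 * y k"
      using y [OF that(1)] y [OF that(2)] by linarith+
    ultimately show "x i + 3 * x k < int p" unfolding sum_eq by linarith
    show "0 \<le> x i + 3 * x k"
      unfolding sum_eq by (intro add_nonneg_nonneg [OF _ ys(2)] mult_nonneg_nonneg) auto
    show "(x i + 3 * x k) div (4 * int h) = int (spread (q i) + 3 * spread (q k))"
      unfolding sum_eq using ys h_pos by (subst div_mult_self4) auto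
  qed
  have x_sum: "(x i + 3 * x k) mod int p = ((n + int i * d)\<^sup>2 + 3 * (n + int k * d)\<^sup>2) mod int p" for i k
    unfolding x_def by (rule mod_add_cong [OF mod_mod_trivial mod_mult_cong [OF refl mod_mod_trivial]])
  \<comment> \<open>The third difference of a quadratic vanishes; the terms are arranged to have
    positive coefficients on both sides.\<close>
  have "(n + int 0 * d)\<^sup>2 + 3 * (n + int 2 * d)\<^sup>2 = (n + int 3 * d)\<^sup>2 + 3 * (n + int 1 * d)\<^sup>2"
    by (simp add: power2_eq_square algebra_simps)
  then have "(x 0 + 3 * x 2) mod int p = (x 3 + 3 * x 1) mod int p"
    unfolding x_sum by (rule arg_cong)
  then have "x 0 + 3 * x 2 = x 3 + 3 * x 1"
    using sum_less [of 0 2] sum_nonneg [of 0 2] sum_less [of 3 1] sum_nonneg [of 3 1] by simp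
  then have "int (spread (q 0) + 3 * spread (q 2)) = int (spread (q 3) + 3 * spread (q 1))"
    using sum_div [of 0 2] sum_div [of 3 1] by simp
  then have "spread (q 0) + 3 * spread (q 2) = spread (q 3) + 3 * spread (q 1)"
    by (simp only: of_nat_eq_iff)
  then have "q 0 = q 3 \<and> q 2 = q 1" by (rule spread_inj)
  then have "symmetrically_colored L b (n mod int L) (d mod int L)"
    by (simp add: symmetrically_colored_def q_def)
  moreover have "n mod int L \<in> ZMod L" "d mod int L \<in> ZMod L"
    using L_pos by (auto simp: ZMod_def)
  ultimately show False
    using b(2) d unfolding has_symmetric_4AP_def by blast
qed

lemma sparse_uniform_set:
  defines "\<delta> \<equiv> real h / real p" and "\<tau> \<equiv> harm p / sqrt (real p)"
  shows "\<exists>A \<subseteq> ZMod (L * p). fourier_uniform \<tau> (L * p) A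
    \<and> real (card A) \<ge> (\<delta> - \<tau>) * real (L * p)
    \<and> Lambda4 (L * p) (indicat_real A) \<le> (\<delta> * (\<delta> + \<tau>)\<^sup>2 + \<tau>) / real L"
proof (intro exI conjI)
  show "quad_set L p J \<subseteq> ZMod (L * p)" by (auto simp: quad_set_def)
  show "fourier_uniform \<tau> (L * p) (quad_set L p J)"
    unfolding \<tau>_def by (rule fourier_uniform_quad_set) simp
  show "real (card (quad_set L p J)) \<ge> (\<delta> - \<tau>) * real (L * p)"
    unfolding \<delta>_def \<tau>_def by (rule card_quad_set)
  show "Lambda4 (L * p) (indicat_real (quad_set L p J)) \<le> (\<delta> * (\<delta> + \<tau>)\<^sup>2 + \<tau>) / real L"
    unfolding \<delta>_def \<tau>_def by (rule Lambda4_quad_set [OF AP4_quad_set_imp])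
qed

end

section \<open>Bounds for \<open>rho4\<close> and the choice of parameters\<close>

text \<open>For large primes \<open>p\<close> the constructed sets have density close to \<beta> and
  are as uniform as desired, so the limit of their bounds on \<open>Lambda4\<close> limits every
  admissible \<rho>.\<close>

lemma rho4_admissible_le:
  fixes L j R :: nat and b :: "int \<Rightarrow> nat"
  assumes L: "L > 0" and b: "coloring R L b" "\<not> has_symmetric_4AP L b" and R: "R \<le> 3 ^ j"
  defines "\<beta> \<equiv> 1 / (4 * 9 ^ j) :: real"
  assumes \<alpha>: "\<alpha> \<le> \<beta>" and \<rho>: "rho4_admissible \<alpha> \<rho>"
  shows "\<rho> \<le> \<beta> ^ 3 / real L"
proof (rule field_le_epsilon)
  fix \<epsilon>' :: real
  assume "\<epsilon>' > 0"
  \<comment> \<open>One \<epsilon> is lost in admissibility; four more are reserved for the error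
    \<open>4 * \<tau> p\<close>.\<close>
  define \<epsilon> where "\<epsilon> = \<epsilon>' / 5"
  have \<epsilon>: "\<epsilon> > 0" using \<open>\<epsilon>' > 0\<close> by (simp add: \<epsilon>_def)
  from \<rho> \<epsilon> obtain \<eta> N0 where \<eta>: "\<eta> > 0" and adm: "\<And>N A. N \<ge> N0 \<Longrightarrow> 0 < N \<Longrightarrow> A \<subseteq> ZMod N
      \<Longrightarrow> fourier_uniform \<eta> N A \<Longrightarrow> real (card A) \<ge> (\<alpha> - \<epsilon>) * real N
      \<Longrightarrow> Lambda4 N (indicat_real A) \<ge> \<rho> - \<epsilon>"
    unfolding rho4_admissible_def by meson
  define \<tau> where "\<tau> p = harm p / sqrt (real p)" for p
  \<comment> \<open>The two halves of \<epsilon> pay for the Fourier error and for the rounding in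
    \<open>h\<close>, so that
    \<open>\<alpha> - \<epsilon> \<le> \<delta> - \<tau> p\<close>.\<close>
  have "eventually (\<lambda>p. \<tau> p < min (min 1 \<eta>) (\<epsilon> / 2)) sequentially"
    unfolding \<tau>_def using \<eta> \<epsilon> by (intro order_tendstoD(2) [OF harm_over_sqrt_tendsto_0]) auto
  moreover have "eventually (\<lambda>p. inverse (real p) < \<epsilon> / 2) sequentially"
    using \<epsilon> by (intro order_tendstoD(2) [OF lim_inverse_n]) auto
  ultimately obtain p0 where p0: "\<And>p. p \<ge> p0 \<Longrightarrow> \<tau> p < min (min 1 \<eta>) (\<epsilon> / 2) \<and> inverse (real p) < \<epsilon> / 2"
    using eventually_conj unfolding eventually_sequentially by (metis (no_types, lifting) le_cases order_trans)
  obtain p where p: "prime p" and p_gt: "p > p0 + N0 + 2 * L"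
    using bigger_prime by blast
  have p_pos: "p > 0" using p_gt by simp
  have cop: "coprime (2 * L) p"
  proof -
    have "\<not> p dvd 2 * L" using L p_gt by (auto dest!: dvd_imp_le)
    then show ?thesis using p prime_imp_coprime coprime_commute by blast
  qed
  define h where "h = p div (4 * 9 ^ j)"
  define \<delta> where "\<delta> = real h / real p"
  have \<tau>: "0 \<le> \<tau> p" "\<tau> p \<le> 1" "\<tau> p \<le> \<eta>" "\<tau> p \<le> \<epsilon> / 2" "inverse (real p) \<le> \<epsilon> / 2"
    using p0 [of p] p_gt by (auto simp: \<tau>_def harm_nonneg)
  have \<delta>_le: "\<delta> \<le> \<beta>"
  proof -
    have "real (h * (4 * 9 ^ j)) \<le> real p"
      unfolding h_def of_nat_le_iff by (rule div_times_less_eq_dividend)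
    then show ?thesis using p_pos by (simp add: \<delta>_def \<beta>_def field_simps)
  qed
  have \<delta>_ge: "\<beta> - inverse (real p) \<le> \<delta>"
  proof -
    have "p < (h + 1) * (4 * 9 ^ j)"
      unfolding h_def using dividend_less_div_times [of "4 * 9 ^ j" p] by simp
    then have "real p < real ((h + 1) * (4 * 9 ^ j))" by (simp only: of_nat_less_iff)
    then have "real p * \<beta> \<le> real h + 1"
      by (simp add: \<beta>_def field_simps)
    then have "\<beta> \<le> (real h + 1) / real p" using p_pos by (simp add: pos_le_divide_eq mult.commute)
    then show ?thesis by (simp add: \<delta>_def add_divide_distrib inverse_eq_divide)
  qed
  have "(1::real) \<le> 9 ^ j" by (rule one_le_power) simp
  then have "(1::real) \<le> 4 * 9 ^ j" by linarith
  then have \<beta>: "0 < \<beta>" "\<beta> \<le> 1"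
    by (simp_all add: \<beta>_def)
  have \<delta>0: "0 \<le> \<delta>" by (simp add: \<delta>_def)
  have "\<exists>A \<subseteq> ZMod (L * p). fourier_uniform (\<tau> p) (L * p) A
      \<and> real (card A) \<ge> (\<delta> - \<tau> p) * real (L * p)
      \<and> Lambda4 (L * p) (indicat_real A) \<le> (\<delta> * (\<delta> + \<tau> p)\<^sup>2 + \<tau> p) / real L"
    unfolding \<delta>_def \<tau>_def h_def by (rule sparse_uniform_set [OF L p cop b R])
  then obtain A where A: "A \<subseteq> ZMod (L * p)" and unif: "fourier_uniform (\<tau> p) (L * p) A"
    and card: "real (card A) \<ge> (\<delta> - \<tau> p) * real (L * p)"
    and Lam: "Lambda4 (L * p) (indicat_real A) \<le> (\<delta> * (\<delta> + \<tau> p)\<^sup>2 + \<tau> p) / real L"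
    by blast
  have num: "\<delta> * (\<delta> + \<tau> p)\<^sup>2 + \<tau> p \<le> \<beta> ^ 3 + 4 * \<tau> p"
  proof -
    have "\<delta> * (\<delta> + \<tau> p)\<^sup>2 \<le> \<beta> * (\<beta> + \<tau> p)\<^sup>2"
      using \<delta>_le \<delta>0 \<tau> \<beta> by (intro mult_mono power_mono) auto
    also have "\<dots> = \<beta> ^ 3 + \<tau> p * (2 * (\<beta> * \<beta>) + \<beta> * \<tau> p)"
      by (simp add: power2_eq_square power3_eq_cube algebra_simps)
    \<comment> \<open>As \<beta> and \<open>\<tau> p\<close> are at most \<open>1\<close>, the cross
      terms cost at most \<open>3 * \<tau> p\<close>; the separate \<open>\<tau> p\<close> makes
      four.\<close>
    also have "\<tau> p * (2 * (\<beta> * \<beta>) + \<beta> * \<tau> p) \<le> \<tau> p * 3"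
      using \<tau> \<beta> mult_mono [of \<beta> 1 \<beta> 1] mult_mono [of \<beta> 1 "\<tau> p" 1] by (intro mult_left_mono) auto
    finally show ?thesis by simp
  qed
  have "\<rho> - \<epsilon> \<le> Lambda4 (L * p) (indicat_real A)"
  proof (rule adm)
    have "1 * p \<le> L * p" using L by (intro mult_le_mono1) simp
    then show "N0 \<le> L * p" using p_gt by linarith
    show "0 < L * p" using L p_pos by simp
    show "fourier_uniform \<eta> (L * p) A"
      using unif \<tau>(3) unfolding fourier_uniform_def by (meson order_trans)
    have "(\<alpha> - \<epsilon>) * real (L * p) \<le> (\<delta> - \<tau> p) * real (L * p)"
      using \<alpha> \<delta>_ge \<tau> by (intro mult_right_mono) auto
    then show "(\<alpha> - \<epsilon>) * real (L * p) \<le> real (card A)" using card by linarith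
  qed (rule A)
  also note Lam
  also have "(\<delta> * (\<delta> + \<tau> p)\<^sup>2 + \<tau> p) / real L \<le> (\<beta> ^ 3 + 4 * \<tau> p) / real L"
    by (rule divide_right_mono [OF num]) simp
  also have "(\<beta> ^ 3 + 4 * \<tau> p) / real L \<le> \<beta> ^ 3 / real L + 4 * \<epsilon>"
  proof -
    have "4 * \<tau> p / real L \<le> 4 * \<epsilon>"
    proof -
      have "\<epsilon> * 1 \<le> \<epsilon> * real L" using \<epsilon> L by (intro mult_left_mono) auto
      then have "4 * \<tau> p \<le> 4 * \<epsilon> * real L" using \<tau>(4) \<epsilon> by linarith
      then show ?thesis using L by (simp add: pos_divide_le_eq)
    qed
    then show ?thesis by (simp add: add_divide_distrib)
  qed
  finally show "\<rho> \<le> \<beta> ^ 3 / real L + \<epsilon>'"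
    using \<epsilon>_def by linarith
qed

text \<open>Rounding \<open>r ^ k\<close> up to a power of \<open>3\<close> costs at most a factor
  \<open>9\<close> in \<open>9 ^ j\<close>; with the factor \<open>4\<close> in the interval length
  this accounts for \<open>36\<close>.\<close>

lemma rho4_le_power_coloring:
  assumes "r \<ge> 2" "N > 0" "coloring r N c" "\<not> has_symmetric_4AP N c"
    and \<alpha>: "\<alpha> * (36 * real r ^ (2 * k)) \<le> 1"
  shows "rho4 \<alpha> \<le> (1 / real r ^ (2 * k)) ^ 3 / real N ^ k"
proof -
  obtain b where b: "coloring (r ^ k) (N ^ k) b" "\<not> has_symmetric_4AP (N ^ k) b"
    using power_coloring [OF assms(2-4)] by blast
  obtain i where i: "3 ^ i \<le> r ^ k" "r ^ k < 3 ^ (i + 1)"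
    using ex_power_ivl1 [of 3 "r ^ k"] assms(1) by auto
  define j where "j = i + 1"
  have "real (3 ^ i) \<le> real (r ^ k)" "real (r ^ k) \<le> real (3 ^ (i + 1))"
    using i by (simp_all only: of_nat_le_iff less_imp_le)
  then have j: "real r ^ k \<le> 3 ^ j" "3 ^ j \<le> 3 * real r ^ k"
    by (simp_all add: j_def)
  have r_pos: "real r ^ k > 0" using assms(1) by simp
  have nine: "(9::real) ^ j = (3 ^ j)\<^sup>2" by (simp add: power2_eq_square flip: power_mult_distrib)
  have r2: "real r ^ (2 * k) = (real r ^ k)\<^sup>2" by (simp add: power_mult mult.commute flip: power_mult)
  have j2: "real r ^ (2 * k) \<le> 9 ^ j" "9 ^ j \<le> 9 * real r ^ (2 * k)"
    using power_mono [OF j(1), of 2] power_mono [OF j(2), of 2] by (simp_all add: nine r2 power_mult_distrib)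
  have R: "r ^ k \<le> 3 ^ j" using i(2) by (simp add: j_def)
  have "\<alpha> \<le> 1 / (36 * real r ^ (2 * k))"
    using \<alpha> r_pos assms(1) by (simp add: pos_le_divide_eq)
  also have "\<dots> \<le> 1 / (4 * 9 ^ j)"
    using j2(2) assms(1) by (intro divide_left_mono) auto
  finally have \<alpha>_le: "\<alpha> \<le> 1 / (4 * 9 ^ j)" .
  have "rho4 \<alpha> \<le> (1 / (4 * 9 ^ j)) ^ 3 / real (N ^ k)"
    unfolding rho4_def
    by (rule cSup_least) (use rho4_admissible_zero rho4_admissible_le [OF _ b R \<alpha>_le] assms(2) in auto)
  also have "\<dots> \<le> (1 / real r ^ (2 * k)) ^ 3 / real (N ^ k)"
  proof -
    have "(0::real) \<le> 9 ^ j" by simp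
    with j2(1) have "real r ^ (2 * k) \<le> 4 * 9 ^ j" by linarith
    then show ?thesis
      using assms(1) by (intro divide_right_mono power_mono divide_left_mono) auto
  qed
  finally show ?thesis by simp
qed

theorem theorem1p8:
  fixes r N :: nat
  assumes "r \<ge> 2" and "N \<ge> 1"
    and "\<exists>c. coloring r N c \<and> \<not> has_symmetric_4AP N c"
  shows "\<exists>C::real. \<forall>\<alpha>::real. 0 < \<alpha> \<and> \<alpha> < 1 / 2 \<longrightarrow>
           rho4 \<alpha> \<le> C * \<alpha> powr (3 + 1 / 2 * log (real r) (real N))"
proof -
  obtain c where c: "coloring r N c" "\<not> has_symmetric_4AP N c" using assms(3) by blast
  \<comment> \<open>With this exponent \<open>real N ^ k\<close> is \<open>real r ^ (2 * k)\<close>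
    to the power \<open>l\<close>.\<close>
  define l where "l = 1 / 2 * log (real r) (real N)"
  have l: "l \<ge> 0" using assms(1,2) by (simp add: l_def)
  have r2: "real r ^ 2 \<ge> 1" "r\<^sup>2 \<ge> 2"
    using assms(1) power_mono [of 2 r 2] by (simp_all add: one_le_power)
  \<comment> \<open>In the constant, \<open>36\<close> comes from the condition on \<alpha> for
    power colorings, and \<open>real r ^ 2\<close> is lost by rounding to an integer
    \<open>k\<close>.\<close>
  have "rho4 \<alpha> \<le> (36 * real r ^ 2) powr (3 + l) * \<alpha> powr (3 + l)" if \<alpha>: "0 < \<alpha>" "\<alpha> < 1 / 2" for \<alpha>
  proof -
    define y where "y = 36 * real r ^ 2 * \<alpha>"
    have y_pos: "y > 0" using \<alpha> assms(1) by (simp add: y_def)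
    have "rho4 \<alpha> \<le> y powr (3 + l)"
    proof (cases "36 * \<alpha> \<le> 1")
      \<comment> \<open>For large \<alpha> no coloring is used: \<open>rho4 \<alpha> \<le> 1\<close>
        and \<open>y \<ge> 1\<close>.\<close>
      case False
      have "rho4 \<alpha> \<le> 1"
        unfolding rho4_def using rho4_admissible_zero \<alpha>
        by (intro cSup_least) (auto intro: rho4_admissible_le_one [of \<alpha>])
      moreover have "1 \<le> y"
        using False r2(1) \<alpha> mult_mono [of 1 "36 * \<alpha>" 1 "real r ^ 2"] by (simp add: y_def mult_ac)
      then have "1 \<le> y powr (3 + l)" using l by (intro ge_one_powr_ge_zero) auto
      ultimately show ?thesis by linarith
    next
      case True
      \<comment> \<open>The integer part brackets 1 / (36 \<alpha>) between consecutive powers of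
        r^2: since \<open>K\<close> is an integer, \<open>K < (r\<^sup>2) ^ (k + 1)\<close> gives
        \<open>K + 1 \<le> (r\<^sup>2) ^ (k + 1)\<close>.\<close>
      define K where "K = nat \<lfloor>1 / (36 * \<alpha>)\<rfloor>"
      have one_le: "1 \<le> 1 / (36 * \<alpha>)" using True \<alpha> by (simp add: pos_le_divide_eq)
      then have K: "K \<ge> 1" "real K \<le> 1 / (36 * \<alpha>)" "1 / (36 * \<alpha>) < real K + 1"
        unfolding K_def by linarith+
      obtain k where k: "(r\<^sup>2) ^ k \<le> K" "K < (r\<^sup>2) ^ (k + 1)"
        using ex_power_ivl1 [OF r2(2) K(1)] by blast
      define z where "z = real r ^ (2 * k)"
      have z_pos: "z > 0" using assms(1) by (simp add: z_def)
      have "real ((r\<^sup>2) ^ k) \<le> real K" "real (Suc K) \<le> real ((r\<^sup>2) ^ (k + 1))"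
        using k by (simp_all only: of_nat_le_iff Suc_le_eq)
      moreover have "real ((r\<^sup>2) ^ k) = z" "real ((r\<^sup>2) ^ (k + 1)) = z * real r ^ 2"
        by (simp_all add: z_def power_mult)
      ultimately have "z \<le> 1 / (36 * \<alpha>)" "1 / (36 * \<alpha>) < z * real r ^ 2"
        using K(2,3) by linarith+
      then have z: "\<alpha> * (36 * z) \<le> 1" "1 / z < y"
        using \<alpha> z_pos by (simp_all add: y_def field_simps)
      have N_powr: "1 / real N ^ k = (1 / z) powr l"
      proof -
        have "z powr l = real r powr (real (2 * k) * l)"
          using assms(1) by (simp add: z_def powr_powr flip: powr_realpow)
        also have "real (2 * k) * l = log (real r) (real N) * real k" by (simp add: l_def)
        also have "real r powr \<dots> = real N ^ k"
          using assms(1,2) by (simp add: powr_powr [symmetric] powr_realpow)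
        finally show ?thesis using z_pos by (simp add: powr_divide)
      qed
      have "rho4 \<alpha> \<le> (1 / z) ^ 3 / real N ^ k"
        unfolding z_def using assms(1,2) c z(1)
        by (intro rho4_le_power_coloring) (auto simp: z_def)
      also have "\<dots> = (1 / z) powr 3 * (1 / z) powr l"
        using z_pos by (simp add: N_powr [symmetric])
      also have "\<dots> = (1 / z) powr (3 + l)" by (rule powr_add [symmetric])
      also have "\<dots> \<le> y powr (3 + l)"
        using z(2) z_pos l by (intro powr_mono2) auto
      finally show ?thesis .
    qed
    also have "y powr (3 + l) = (36 * real r ^ 2) powr (3 + l) * \<alpha> powr (3 + l)"
      using \<alpha> unfolding y_def by (intro powr_mult)
    finally show ?thesis .
  qed
  then show ?thesis unfolding l_def by blast
qed

end
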